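(* Let $(z,z')$ be admissible and $t=zz'$. Then $$\sigma^{(zz')}_1=\Gamma(t+1)\,\big(\phi_{z,-z}*\phi^{(-)}_{-z',z'}\big)\odot\phi_{1,t-2},$$ and consequently the first correlation (density) measure of the process $\mathcal P_{zz'}$ is, for $x\neq0$, $$\rho^{(zz')}_1(x)=\frac{\Gamma(t+1)}{|x|}\Big\{\big(\phi_{z,-z}*\phi^{(-)}_{-z',z'}\big)\odot\phi_{1,t-2}\Big\}(x).$$
   Context: Admissible parameters: either $z'=\bar z$, $z\notin\mathbb Z$, or $z,z'$ real in a common interval $(m,m+1)$, $m\in\mathbb Z$. $\sigma^{(zz')}_1$ is the first controlling measure of the spectral $z$-measure $P_{zz'}$ on the Thoma simplex; it is the unique measure on $[-1,1]$ with moments $\int x^l\sigma^{(zz')}_1(dx)=\sum_{p+q=l,\ p,q\ge0}\frac{(-1)^q\,t\,(z+1)_p(-z+1)_q(z'+1)_p(-z'+1)_q}{(t)_{p+q+1}(p+q+1)p!q!}$, $l\ge0$, and the density measure of the associated point process $\mathcal P_{zz'}$ on $I=[-1,1]\setminus\{0\}$ (random configuration of nonzero $\alpha_i$ and $-\beta_j$) is $\rho^{(zz')}_1=|x|^{-1}\sigma^{(zz')}_1|_I$. For $a\in\mathbb C$, $\phi_a(u)=u_+^a/\Gamma(a+1)$ (distribution on $\mathbb R$, analytically continued in $a$); $\phi_{ab}(u)=\phi_a(u)\phi_b(1-u)$; $\phi^{(-)}_{ab}(u)=\phi_{ab}(-u)$; $*$ is additive convolution; for compactly supported distributions, $\langle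 A\odot B,\psi\rangle=\langle A(y_1)\otimes B(y_2),\psi(y_1y_2)\rangle$. *)

theory Defs
  imports "HOL-Analysis.Analysis"
begin

definition admissible :: "complex \<Rightarrow> complex \<Rightarrow> bool" where
  "admissible z z' \<longleftrightarrow>
     (z' = cnj z \<and> z \<notin> \<int>) \<or>
     (Im z = 0 \<and> Im z' = 0 \<and>
      (\<exists>m::int. of_int m < Re z \<and> Re z < of_int m + 1 \<and>
                 of_int m < Re z' \<and> Re z' < of_int m + 1))"

definition sigma1_moment :: "complex \<Rightarrow> complex \<Rightarrow> nat \<Rightarrow> complex" where
  "sigma1_moment z z' l =
     (let t = z * z' in
      \<Sum>p = 0..l. let q = l - p in
        (-1) ^ q * t * pochhammer (z + 1) p * pochhammer (- z + 1) q
          * pochhammer (z' + 1) p * pochhammer (- z' + 1) q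
        / (pochhammer t (p + q + 1) * of_nat (p + q + 1) * fact p * fact q))"

definition rho1 :: "real measure \<Rightarrow> real measure" where
  "rho1 \<sigma> = density \<sigma> (\<lambda>x. ennreal (indicator ({-1..1} - {0}) x / \<bar>x\<bar>))"

definition vderiv :: "(real \<Rightarrow> complex) \<Rightarrow> real \<Rightarrow> complex" where
  "vderiv f = (\<lambda>x. vector_derivative f (at x))"

definition test_fun :: "(real \<Rightarrow> complex) \<Rightarrow> bool" where
  "test_fun \<psi> \<longleftrightarrow> (\<forall>n x. (vderiv ^^ n) \<psi> differentiable (at x)) \<and> bounded {x. \<psi> x \<noteq> 0}"

type_synonym distr = "(real \<Rightarrow> complex) \<Rightarrow> complex"

text \<open>phi_{ab}(u) = u_+^a (1-u)_+^b / (Gamma(a+1) Gamma(b+1)) as a distribution,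
  analytically continued (separately entire in a and in b) from Re a, Re b > -1.\<close>
definition phi_ab_family :: "complex \<Rightarrow> complex \<Rightarrow> distr" where
  "phi_ab_family = (THE F.
     (\<forall>\<psi>. test_fun \<psi> \<longrightarrow>
        (\<forall>b. (\<lambda>a. F a b \<psi>) holomorphic_on UNIV) \<and> (\<forall>a. (\<lambda>b. F a b \<psi>) holomorphic_on UNIV)) \<and>
     (\<forall>\<psi> a b. test_fun \<psi> \<longrightarrow> Re a > -1 \<longrightarrow> Re b > -1 \<longrightarrow>
        F a b \<psi> = integral {0..1} (\<lambda>u. (complex_of_real u powr a) * (complex_of_real (1 - u) powr b)
                      * rGamma (a + 1) * rGamma (b + 1) * \<psi> u)) \<and>
     (\<forall>\<psi> a b. \<not> test_fun \<psi> \<longrightarrow> F a b \<psi> = 0))"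

definition phi_ab :: "complex \<Rightarrow> complex \<Rightarrow> distr" where
  "phi_ab a b = phi_ab_family a b"

definition reflect :: "distr \<Rightarrow> distr" where
  "reflect T = (\<lambda>\<psi>. T (\<lambda>u. \<psi> (- u)))"

text \<open>Pairing of a compactly supported distribution with a smooth function:
  <B,f> = <B, chi f> for any test function chi with (1 - chi) B = 0
  (independent of the choice of chi).\<close>
definition cutoff_for :: "distr \<Rightarrow> (real \<Rightarrow> complex) \<Rightarrow> bool" where
  "cutoff_for B c \<longleftrightarrow> test_fun c \<and> (\<forall>\<psi>. test_fun \<psi> \<longrightarrow> B (\<lambda>x. (1 - c x) * \<psi> x) = 0)"

definition ext_pair :: "distr \<Rightarrow> (real \<Rightarrow> complex) \<Rightarrow> complex" where
  "ext_pair B f = B (\<lambda>x. (SOME c. cutoff_for B c) x * f x)"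

text \<open>Additive convolution and multiplicative convolution of compactly supported
  distributions: <A*B,psi> = <A(y1) (x) B(y2), psi(y1+y2)>,
  <A o B,psi> = <A(y1) (x) B(y2), psi(y1 y2)>, via iterated pairing.\<close>
definition conv :: "distr \<Rightarrow> distr \<Rightarrow> distr" where
  "conv A B = (\<lambda>\<psi>. ext_pair A (\<lambda>y1. ext_pair B (\<lambda>y2. \<psi> (y1 + y2))))"

definition mconv :: "distr \<Rightarrow> distr \<Rightarrow> distr" where
  "mconv A B = (\<lambda>\<psi>. ext_pair A (\<lambda>y1. ext_pair B (\<lambda>y2. \<psi> (y1 * y2))))"

end

theory Submission
  imports Defs "HOL-Complex_Analysis.Complex_Analysis"
begin

text \<open>Both sides of the formula are functionals of finite order supported in a fixed compact
  interval, hence continuous for the supremum of finitely many derivatives there; since polynomials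
  are dense for this topology (integrate the Weierstrass approximation of a high derivative), it
  suffices to compare moments. The moments of \<open>\<phi>\<^sub>a\<^sub>b\<close> are \<open>(a + 1)\<^sub>p / \<Gamma>(a + b + p + 2)\<close>, by analytic
  continuation from the beta integral, and additive and multiplicative convolution act on moments
  by the binomial formula and by multiplication. The remaining finite identity follows by expanding
  \<open>(z + 1)\<^sub>p (1 - z)\<^sub>q\<close> in the basis \<open>(z + 1)\<^sub>j\<close> and applying Chu--Vandermonde twice.\<close>

section \<open>Smooth functions\<close>

text \<open>Polynomials are not test functions, and \<open>phi_ab\<close> is specified to vanish off
  the test functions, so a moment of \<open>phi_ab\<close> has a meaning only through
  \<open>ext_pair\<close>, whose cutoff is an unspecified choice. Every functional therefore carries
  a radius \<open>r\<close>: it sees only derivatives on [-r,r], so all bumps equal to 1 near [-r,r]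
  give the same pairing. Iterated pairings need more: the inner one must be smooth in the outer
  variable, with derivatives controlled by those of the test function. This is why the order is
  tracked together with explicit bounds. The other obstacle is that Re z is arbitrary, so the
  integral for \<open>phi_ab z (- z)\<close> may diverge, and that the family is given by
  \<open>THE\<close>. Existence comes from an integration by parts that raises both exponents by one
  and can be iterated; uniqueness comes from continuation in one parameter at a time. Admissibility
  enters through zz' > 0, which keeps Gamma(t+1) and \<open>pochhammer t (l + 1)\<close> finite and
  nonzero.\<close>

definition smooth :: "(real \<Rightarrow> complex) \<Rightarrow> bool" where
  "smooth f \<longleftrightarrow> (\<forall>n x. (vderiv ^^ n) f differentiable (at x))"

lemma test_fun_smooth: "test_fun f \<Longrightarrow> smooth f"
  by (simp add: test_fun_def smooth_def)

lemma vderivI: "(\<And>x. (f has_vector_derivative g x) (at x)) \<Longrightarrow> vderiv f = g"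
  by (auto simp: vderiv_def vector_derivative_at)

text \<open>All iterated derivatives stay inside \<open>X\<close>, and members of \<open>X\<close>
  are differentiable. Smoothness thus reduces to finding a class stable under one differentiation,
  with no formula for higher derivatives.\<close>

lemma smooth_coinduct:
  assumes "X f"
    and step: "\<And>f. X f \<Longrightarrow> \<exists>g. X g \<and> (\<forall>x. (f has_vector_derivative g x) (at x))"
  shows "smooth f"
proof -
  have X: "X ((vderiv ^^ n) f)" for n
  proof (induction n)
    case (Suc n)
    obtain g where "X g" "\<And>x. ((vderiv ^^ n) f has_vector_derivative g x) (at x)"
      using step[OF Suc] by blast
    then show ?case using vderivI[of "(vderiv ^^ n) f" g] by simp
  qed (use assms(1) in simp)
  show ?thesis
    unfolding smooth_def
  proof (intro allI)
    fix n x
    show "(vderiv ^^ n) f differentiable at x"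
      using step[OF X[of n]] differentiableI_vector by blast
  qed
qed

lemma smooth_funpow: "smooth f \<Longrightarrow> smooth ((vderiv ^^ n) f)"
  unfolding smooth_def by (metis comp_apply funpow_add)

lemma smooth_vderiv: "smooth f \<Longrightarrow> smooth (vderiv f)"
  using smooth_funpow[of f 1] by simp

lemma smooth_deriv: "smooth f \<Longrightarrow> (f has_vector_derivative vderiv f x) (at x within S)"
proof -
  assume "smooth f"
  then have "f differentiable (at x)"
    unfolding smooth_def by (metis funpow_0)
  then have "(f has_vector_derivative vderiv f x) (at x)"
    unfolding vderiv_def by (rule vector_derivative_works[THEN iffD1])
  then show ?thesis by (rule has_vector_derivative_at_within)
qed

lemma smooth_funpow_deriv:
  "smooth f \<Longrightarrow> ((vderiv ^^ n) f has_vector_derivative (vderiv ^^ Suc n) f x) (at x within S)"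
  using smooth_deriv[OF smooth_funpow] by simp

lemma smooth_continuous_on: "smooth f \<Longrightarrow> continuous_on S f"
  unfolding continuous_on_eq_continuous_within
  by (intro ballI has_vector_derivative_continuous[OF smooth_deriv])

lemma smooth_funpow_continuous_on: "smooth f \<Longrightarrow> continuous_on S ((vderiv ^^ n) f)"
  by (intro smooth_continuous_on smooth_funpow)

lemma smooth_const [simp]: "smooth (\<lambda>_. c)"
proof (rule smooth_coinduct[where X = "\<lambda>f. \<exists>c. f = (\<lambda>_. c)"])
  fix f :: "real \<Rightarrow> complex" assume "\<exists>c. f = (\<lambda>_. c)"
  then show "\<exists>g. (\<exists>c. g = (\<lambda>_. c)) \<and> (\<forall>x. (f has_vector_derivative g x) (at x))"
    by (intro exI[of _ "\<lambda>_. 0"]) auto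
qed blast

lemma smooth_step:
  assumes "\<And>x. (f has_vector_derivative g x) (at x)" "smooth g"
  shows "smooth f"
proof (rule smooth_coinduct[where X = "\<lambda>h. h = f \<or> smooth h"])
  fix h assume "h = f \<or> smooth h"
  then show "\<exists>g. (g = f \<or> smooth g) \<and> (\<forall>x. (h has_vector_derivative g x) (at x))"
    using assms smooth_deriv smooth_vderiv by blast
qed simp

lemma has_vector_derivative_complex_of_real: "(complex_of_real has_vector_derivative 1) (at x)"
  using has_vector_derivative_of_real[of "\<lambda>x. x" 1 "at x", where 'a=complex]
  by (simp add: has_real_derivative_iff_has_vector_derivative[symmetric])

lemma smooth_ident [simp]: "smooth complex_of_real"
  by (rule smooth_step[OF has_vector_derivative_complex_of_real smooth_const])

lemma has_vector_derivative_affine: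
  fixes f :: "real \<Rightarrow> complex"
  assumes "(f has_vector_derivative f') (at (a * x + b))"
  shows "((\<lambda>x. f (a * x + b)) has_vector_derivative of_real a * f') (at x)"
proof -
  have "((\<lambda>x. a * x + b) has_vector_derivative a) (at x)"
    by (auto intro!: derivative_eq_intros simp flip: has_real_derivative_iff_has_vector_derivative)
  from vector_diff_chain_at[OF this assms]
  show ?thesis by (simp add: o_def scaleR_conv_of_real)
qed

lemma smooth_affine:
  assumes "smooth f"
  shows "smooth (\<lambda>x. f (a * x + b))"
proof -
  \<comment> \<open>The factor \<open>c\<close> collects the powers of \<open>a\<close> from the
    chain rule; closure of smooth functions under products is not yet available here.\<close>
  let ?X = "\<lambda>h. \<exists>c f. smooth f \<and> h = (\<lambda>x. c * f (a * x + b))"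
  have "?X (\<lambda>x. f (a * x + b))"
    by (rule exI[of _ 1], rule exI[of _ f]) (use assms in simp)
  then show ?thesis
  proof (rule smooth_coinduct)
    fix h assume "?X h"
    then obtain c f where h: "smooth f" "h = (\<lambda>x. c * f (a * x + b))" by blast
    have "(h has_vector_derivative c * of_real a * vderiv f (a * x + b)) (at x)" for x
      unfolding h(2) mult.assoc
      by (intro has_vector_derivative_mult_right has_vector_derivative_affine smooth_deriv h)
    then show "\<exists>g. ?X g \<and> (\<forall>x. (h has_vector_derivative g x) (at x))"
      by (intro exI[of _ "\<lambda>x. c * of_real a * vderiv f (a * x + b)"] conjI
          exI[of _ "c * of_real a"] exI[of _ "vderiv f"] smooth_vderiv h refl allI)
  qed
qed

text \<open>The conclusions are stated through a pointwise equation because \<^verbatim>\<open>inductive\<close> fails to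
  derive the elimination rules from higher-order patterns in the conclusions.\<close>

inductive smooth_closure :: "(real \<Rightarrow> complex) \<Rightarrow> bool" where
  base: "smooth h \<Longrightarrow> smooth_closure h"
| add: "smooth_closure f \<Longrightarrow> smooth_closure g \<Longrightarrow> (\<And>x. h x = f x + g x) \<Longrightarrow> smooth_closure h"
| mult: "smooth_closure f \<Longrightarrow> smooth_closure g \<Longrightarrow> (\<And>x. h x = f x * g x) \<Longrightarrow> smooth_closure h"
| inverse: "smooth_closure f \<Longrightarrow> (\<And>x. f x \<noteq> 0) \<Longrightarrow> (\<And>x. h x = inverse (f x)) \<Longrightarrow> smooth_closure h"
| sgn: "smooth_closure f \<Longrightarrow> (\<forall>\<^sub>F x in nhds 0. f x = 0) \<Longrightarrow>
    (\<And>x. h x = of_real (sgn x) * f x) \<Longrightarrow> smooth_closure h"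
| divide: "smooth_closure f \<Longrightarrow> (\<forall>\<^sub>F x in nhds 0. f x = 0) \<Longrightarrow>
    (\<And>x. h x = f x / of_real x) \<Longrightarrow> smooth_closure h"

lemmas smooth_closure_add = smooth_closure.add[OF _ _ refl]
lemmas smooth_closure_mult = smooth_closure.mult[OF _ _ refl]
lemmas smooth_closure_inverse = smooth_closure.inverse[OF _ _ refl]
lemmas smooth_closure_sgn = smooth_closure.sgn[OF _ _ refl]
lemmas smooth_closure_divide = smooth_closure.divide[OF _ _ refl]

lemma has_vector_derivative_eventually_zero:
  fixes f :: "real \<Rightarrow> complex"
  assumes "\<forall>\<^sub>F x in nhds a. f x = 0"
  shows "(f has_vector_derivative 0) (at a)"
proof -
  obtain S where S: "open S" "a \<in> S" "\<And>x. x \<in> S \<Longrightarrow> f x = 0"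
    using assms unfolding eventually_nhds by blast
  show ?thesis
    by (rule has_vector_derivative_transform_within_open[OF _ S(1,2), of "\<lambda>_. 0"])
      (simp_all add: S(3))
qed

text \<open>At every point near 0 the function again vanishes in a neighbourhood, so its derivative
  there is 0. This hands the side condition of the rules \<open>sgn\<close> and
  \<open>divide\<close> on to derivatives.\<close>

lemma eventually_zero_deriv:
  fixes f :: "real \<Rightarrow> complex"
  assumes "\<forall>\<^sub>F x in nhds 0. f x = 0" and d: "\<And>x. (f has_vector_derivative g x) (at x)"
  shows "\<forall>\<^sub>F x in nhds 0. g x = 0"
proof -
  have "\<forall>\<^sub>F y in nhds 0. \<forall>\<^sub>F x in nhds y. f x = 0"
    using assms(1) by (simp add: eventually_eventually)
  then show ?thesis
  proof eventually_elim
    case (elim x)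
    show ?case
      using vector_derivative_unique_at[OF d has_vector_derivative_eventually_zero[OF elim]] .
  qed
qed

text \<open>The derivative of a product is a sum of products, so no single operation yields a class
  stable under differentiation. The closure under all of them together does, and
  \<open>smooth_coinduct\<close> then applies. The rules \<open>sgn\<close> and
  \<open>divide\<close> are there for the later division by |x|.\<close>

lemma smooth_closure_deriv:
  assumes "smooth_closure f"
  shows "\<exists>g. smooth_closure g \<and> (\<forall>x. (f has_vector_derivative g x) (at x))"
  using assms
proof induction
  case (base f)
  then show ?case using smooth_deriv smooth_vderiv smooth_closure.base by blast
next
  case (add f g h)
  then obtain f' g' where *: "smooth_closure f'" "smooth_closure g'"
    "\<And>x. (f has_vector_derivative f' x) (at x)" "\<And>x. (g has_vector_derivative g' x) (at x)"
    by blast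
  have h: "h = (\<lambda>x. f x + g x)" using add by blast
  show ?case
    unfolding h
    by (intro exI[of _ "\<lambda>x. f' x + g' x"] conjI allI smooth_closure_add has_vector_derivative_add *)
next
  case (mult f g h)
  then obtain f' g' where *: "smooth_closure f'" "smooth_closure g'"
    "\<And>x. (f has_vector_derivative f' x) (at x)" "\<And>x. (g has_vector_derivative g' x) (at x)"
    by blast
  have h: "h = (\<lambda>x. f x * g x)" using mult by blast
  show ?case
    unfolding h
    by (intro exI[of _ "\<lambda>x. f x * g' x + f' x * g x"] conjI allI smooth_closure_add
        smooth_closure_mult has_vector_derivative_mult * mult.hyps)
next
  case (inverse f h)
  then obtain f' where *: "smooth_closure f'" "\<And>x. (f has_vector_derivative f' x) (at x)"
    by blast
  have h: "h = (\<lambda>x. inverse (f x))" using inverse by blast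
  have "(h has_vector_derivative (-1) * f' x * (inverse (f x) * inverse (f x))) (at x)" for x
  proof -
    have "(inverse has_field_derivative - (inverse (f x) * inverse (f x))) (at (f x))"
      using inverse.hyps(2) DERIV_inverse[of "f x" UNIV] by (simp add: power2_eq_square)
    from field_vector_diff_chain_at[OF *(2)[of x] this]
    show ?thesis by (simp add: o_def h mult_ac)
  qed
  moreover have "smooth_closure (\<lambda>x. (-1) * f' x * (inverse (f x) * inverse (f x)))"
    by (intro smooth_closure_mult smooth_closure.base[OF smooth_const] smooth_closure_inverse inverse *)
  ultimately show ?case by blast
next
  case (sgn f h)
  then obtain f' where *: "smooth_closure f'" "\<And>x. (f has_vector_derivative f' x) (at x)"
    by blast
  have h: "h = (\<lambda>x. of_real (sgn x) * f x)" using sgn by blast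
  have f'0: "\<forall>\<^sub>F x in nhds 0. f' x = 0"
    using eventually_zero_deriv sgn.hyps(2) *(2) by blast
  \<comment> \<open>Away from 0 the sign is locally constant; at 0 it multiplies a function that
    vanishes nearby.\<close>
  have "(h has_vector_derivative of_real (sgn x) * f' x) (at x)" for x
  proof (cases "x = 0")
    case True
    have "\<forall>\<^sub>F x in nhds 0. h x = 0"
      using sgn.hyps(2) by eventually_elim (auto simp: h)
    then show ?thesis
      using True has_vector_derivative_eventually_zero by simp
  next
    case False
    show ?thesis
    proof (rule has_vector_derivative_transform_within_open)
      show "((\<lambda>y. of_real (sgn x) * f y) has_vector_derivative of_real (sgn x) * f' x) (at x)"
        by (intro has_vector_derivative_mult_right *)
      show "open (if x > 0 then {0<..} else {..<0::real})" "x \<in> (if x > 0 then {0<..} else {..<0})"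
        using False by auto
    qed (use False in \<open>auto split: if_splits simp: h\<close>)
  qed
  then show ?case using smooth_closure_sgn[OF *(1) f'0] by blast
next
  case (divide f h)
  then obtain f' where *: "smooth_closure f'" "\<And>x. (f has_vector_derivative f' x) (at x)"
    by blast
  have h: "h = (\<lambda>x. f x / of_real x)" using divide by blast
  have f'0: "\<forall>\<^sub>F x in nhds 0. f' x = 0"
    using eventually_zero_deriv divide.hyps(2) *(2) by blast
  \<comment> \<open>The quotient rule divides by x twice, so the rule \<open>divide\<close> is also
    applied to the quotient itself and needs its vanishing near 0.\<close>
  have q0: "\<forall>\<^sub>F x in nhds 0. f x / of_real x = 0"
    using divide.hyps(2) by eventually_elim auto
  have "(h has_vector_derivative f' x / of_real x + (-1) * (f x / of_real x / of_real x)) (at x)" for x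
  proof (cases "x = 0")
    case True
    then show ?thesis
      using has_vector_derivative_eventually_zero[OF q0] by (simp add: h)
  next
    case False
    have "((\<lambda>x. inverse x) has_real_derivative - inverse x * inverse x) (at x)"
      using False by (auto intro!: derivative_eq_intros simp: power2_eq_square)
    then have "((\<lambda>x. of_real (inverse x) :: complex) has_vector_derivative of_real (- inverse x * inverse x)) (at x)"
      by (intro has_vector_derivative_of_real) (simp add: has_real_derivative_iff_has_vector_derivative)
    from has_vector_derivative_mult[OF *(2)[of x] this]
    show ?thesis by (simp add: field_simps h)
  qed
  moreover have "smooth_closure (\<lambda>x. f' x / of_real x + (-1) * (f x / of_real x / of_real x))"
    using smooth_closure_divide[OF *(1) f'0] smooth_closure_divide[OF smooth_closure_divide[OF divide.hyps(1,2)] q0]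
    by (intro smooth_closure_add smooth_closure_mult smooth_closure.base[OF smooth_const]) auto
  ultimately show ?case by blast
qed

lemma smooth_closure_iff: "smooth_closure f \<longleftrightarrow> smooth f"
proof
  assume "smooth_closure f"
  then show "smooth f"
    by (rule smooth_coinduct) (rule smooth_closure_deriv)
qed (rule smooth_closure.base)

lemmas smooth_add = smooth_closure_add[unfolded smooth_closure_iff]
lemmas smooth_mult = smooth_closure_mult[unfolded smooth_closure_iff]
lemmas smooth_inverse = smooth_closure_inverse[unfolded smooth_closure_iff]
lemmas smooth_sgn = smooth_closure_sgn[unfolded smooth_closure_iff]
lemmas smooth_divide_ident = smooth_closure_divide[unfolded smooth_closure_iff]

lemma smooth_cmult: "smooth f \<Longrightarrow> smooth (\<lambda>x. c * f x)"
  by (intro smooth_mult smooth_const)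

lemma smooth_diff: "smooth f \<Longrightarrow> smooth g \<Longrightarrow> smooth (\<lambda>x. f x - g x)"
  using smooth_add[OF _ smooth_cmult[of g "-1"]] by fastforce

lemma smooth_power: "smooth f \<Longrightarrow> smooth (\<lambda>x. f x ^ n)"
  by (induction n) (auto intro: smooth_mult)

lemma smooth_sum: "(\<And>i. i \<in> I \<Longrightarrow> smooth (f i)) \<Longrightarrow> smooth (\<lambda>x. \<Sum>i\<in>I. f i x)"
  by (induction I rule: infinite_finite_induct) (auto intro: smooth_add)

lemma vderiv_funpow_add:
  assumes "smooth f" "smooth g"
  shows "(vderiv ^^ n) (\<lambda>x. f x + g x) = (\<lambda>x. (vderiv ^^ n) f x + (vderiv ^^ n) g x)"
proof (induction n)
  case (Suc n)
  show ?case
    unfolding funpow.simps o_apply[of vderiv] Suc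
    by (rule vderivI, rule has_vector_derivative_add; rule smooth_funpow_deriv[unfolded funpow.simps o_apply]; rule assms)
qed simp

lemma vderiv_funpow_cmult:
  assumes "smooth f"
  shows "(vderiv ^^ n) (\<lambda>x. c * f x) = (\<lambda>x. c * (vderiv ^^ n) f x)"
proof (induction n)
  case (Suc n)
  show ?case
    unfolding funpow.simps o_apply[of vderiv] Suc
    by (rule vderivI, rule has_vector_derivative_mult_right; rule smooth_funpow_deriv[unfolded funpow.simps o_apply]; rule assms)
qed simp

lemma vderiv_funpow_diff:
  assumes "smooth f" "smooth g"
  shows "(vderiv ^^ n) (\<lambda>x. f x - g x) = (\<lambda>x. (vderiv ^^ n) f x - (vderiv ^^ n) g x)"
proof (induction n)
  case (Suc n)
  show ?case
    unfolding funpow.simps o_apply[of vderiv] Suc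
    by (rule vderivI, rule has_vector_derivative_diff; rule smooth_funpow_deriv[unfolded funpow.simps o_apply]; rule assms)
qed simp

lemma vderiv_funpow_affine:
  assumes "smooth f"
  shows "(vderiv ^^ n) (\<lambda>x. f (a * x + b)) = (\<lambda>x. of_real a ^ n * (vderiv ^^ n) f (a * x + b))"
proof (induction n)
  case (Suc n)
  have "((\<lambda>x. of_real a ^ n * (vderiv ^^ n) f (a * x + b)) has_vector_derivative
      of_real a ^ n * (of_real a * (vderiv ^^ Suc n) f (a * x + b))) (at x)" for x
    by (intro has_vector_derivative_mult_right has_vector_derivative_affine smooth_funpow_deriv assms)
  from vderivI[OF this] show ?case using Suc by (auto simp: mult_ac)
qed simp

lemma vderiv_funpow_cong_open:
  assumes "open S" "x \<in> S" "\<And>y. y \<in> S \<Longrightarrow> f y = g y"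
  shows "(vderiv ^^ n) f x = (vderiv ^^ n) g x"
  using assms(2)
proof (induction n arbitrary: x)
  case (Suc n)
  have "\<forall>\<^sub>F y in nhds x. (vderiv ^^ n) f y = (vderiv ^^ n) g y"
    using assms(1) Suc eventually_nhds by blast
  then have "vector_derivative ((vderiv ^^ n) f) (at x) = vector_derivative ((vderiv ^^ n) g) (at x)"
    by (intro vector_derivative_cong_eq) auto
  then show ?case by (simp add: vderiv_def[of "(vderiv ^^ n) _"])
qed (use assms in auto)

lemma vderiv_const [simp]: "vderiv (\<lambda>_. c) = (\<lambda>_. 0)"
  by (intro vderivI) simp

lemma vderiv_funpow_const: "(vderiv ^^ n) (\<lambda>_. c) = (\<lambda>_. if n = 0 then c else 0)"
  by (induction n) auto

section \<open>Cutoffs and functionals of finite order\<close>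

text \<open>The classical function exp(-1/x), flat at 0. The polynomial in 1/x makes the family
  stable under differentiation.\<close>

definition flat :: "real poly \<Rightarrow> real \<Rightarrow> real" where
  "flat p x = (if x > 0 then poly p (inverse x) * exp (- inverse x) else 0)"

lemma poly_exp_tendsto_0: "((\<lambda>x. poly p x * exp (- x)) \<longlongrightarrow> 0) (at_top :: real filter)"
proof -
  have "((\<lambda>x. \<Sum>i\<le>degree p. coeff p i * (x ^ i / exp x)) \<longlongrightarrow> (\<Sum>i\<le>degree p. coeff p i * 0)) (at_top :: real filter)"
    by (intro tendsto_sum tendsto_mult tendsto_const tendsto_power_div_exp_0)
  then show ?thesis
    by (simp add: poly_altdef exp_minus sum_distrib_right divide_inverse mult.assoc)
qed

lemma flat_tendsto_0: "(flat p \<longlongrightarrow> 0) (at 0)"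
proof -
  have "((\<lambda>x. poly p (inverse x) * exp (- inverse x)) \<longlongrightarrow> 0) (at_right 0)"
    using filterlim_compose[OF poly_exp_tendsto_0 filterlim_inverse_at_top_right] .
  then have r: "(flat p \<longlongrightarrow> 0) (at_right 0)"
    by (rule Lim_transform_eventually) (auto simp: eventually_at_filter flat_def)
  have "((\<lambda>_. 0) \<longlongrightarrow> (0::real)) (at_left 0)" by simp
  then have l: "(flat p \<longlongrightarrow> 0) (at_left 0)"
    by (rule Lim_transform_eventually) (auto simp: eventually_at_filter flat_def)
  show ?thesis using l r by (rule filterlim_split_at)
qed

text \<open>For x > 0 the derivative of p(1/x) exp(-1/x) is x^(-2) (p(1/x) - p'(1/x)) exp(-1/x),
  whence the new polynomial; the only delicate point is x = 0.\<close>

lemma flat_deriv: "(flat p has_real_derivative flat (monom 1 2 * (p - pderiv p)) x) (at x)"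
proof -
  consider "x > 0" | "x = 0" | "x < 0" by linarith
  then show ?thesis
  proof cases
    case 1
    have "((\<lambda>x. poly p (inverse x) * exp (- inverse x)) has_real_derivative
        flat (monom 1 2 * (p - pderiv p)) x) (at x)"
      using 1 by (auto intro!: derivative_eq_intros poly_DERIV[THEN DERIV_chain2]
          simp: flat_def poly_monom power2_eq_square algebra_simps)
    from has_field_derivative_transform_within_open[OF this, of "{0<..}"] show ?thesis
      using 1 by (auto simp: flat_def)
  next
    case 2
    \<comment> \<open>The difference quotient \<open>flat p h / h\<close> is again of the same form,
      with p multiplied by the variable 1/h.\<close>
    have "((\<lambda>h. flat ([:0, 1:] * p) h) \<longlongrightarrow> 0) (at 0)" by (rule flat_tendsto_0)
    then have "((\<lambda>h. (flat p (0 + h) - flat p 0) / h) \<longlongrightarrow> 0) (at 0)"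
      by (rule Lim_transform_eventually)
        (auto simp: eventually_at_filter flat_def field_simps)
    then show ?thesis using 2 by (simp add: DERIV_def flat_def)
  next
    case 3
    have "((\<lambda>_. 0) has_real_derivative 0) (at x)" by simp
    from has_field_derivative_transform_within_open[OF this, of "{..<0}"]
    have "(flat p has_real_derivative 0) (at x)"
      using 3 by (auto simp: flat_def)
    then show ?thesis using 3 by (simp add: flat_def)
  qed
qed

lemma smooth_flat: "smooth (\<lambda>x. of_real (flat p x))"
proof -
  let ?X = "\<lambda>f. \<exists>p. f = (\<lambda>x. complex_of_real (flat p x))"
  have "?X (\<lambda>x. of_real (flat p x))" by blast
  then show ?thesis
  proof (rule smooth_coinduct)
    fix f assume "?X f"
    then obtain p where f: "f = (\<lambda>x. complex_of_real (flat p x))" by blast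
    have "(f has_vector_derivative of_real (flat (monom 1 2 * (p - pderiv p)) x)) (at x)" for x
      unfolding f using flat_deriv
      by (intro has_vector_derivative_of_real)
        (simp add: has_real_derivative_iff_has_vector_derivative)
    then show "\<exists>g. ?X g \<and> (\<forall>x. (f has_vector_derivative g x) (at x))" by blast
  qed
qed

text \<open>With F(x) = exp(-1/x) for x > 0 and 0 otherwise, F(x) + F(1-x) never vanishes, and s(x)
  = F(x) / (F(x) + F(1-x)) is a smooth step from 0 (x <= 0) to 1 (x >= 1). The product s(r+1-x)
  s(r+1+x) is the plateau. Arguments are written as \<open>a * x + b\<close> to fit
  \<open>smooth_affine\<close>.\<close>

lemma bump_exists:
  obtains c where "test_fun c" "\<forall>x. \<bar>x\<bar> < r \<longrightarrow> c x = 1"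
proof -
  define F where "F x = complex_of_real (flat 1 x)" for x
  define D where "D x = F x + F (- 1 * x + 1)" for x
  define s where "s x = F x * inverse (D x)" for x
  define c where "c x = s ((-1) * x + (r + 1)) * s (1 * x + (r + 1))" for x
  have pos: "flat 1 x > 0 \<or> flat 1 (1 - x) > 0" "flat 1 x \<ge> 0" for x
    by (auto simp: flat_def)
  have D0: "\<forall>x. D x \<noteq> 0"
  proof
    fix x
    have "D x = of_real (flat 1 x + flat 1 (1 - x))" by (simp add: D_def F_def)
    moreover have "flat 1 x + flat 1 (1 - x) > 0"
      using pos(1)[of x] pos(2)[of x] pos(2)[of "1 - x"] by linarith
    ultimately show "D x \<noteq> 0" by (simp del: of_real_add)
  qed
  have F: "smooth F" unfolding F_def by (rule smooth_flat)
  have "smooth D"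
    unfolding D_def by (intro smooth_add F smooth_affine)
  then have s: "smooth s"
    unfolding s_def using D0 by (intro smooth_mult F smooth_inverse) auto
  have c: "smooth c"
    unfolding c_def by (intro smooth_mult smooth_affine s)
  have s1: "s x = 1" if "x \<ge> 1" for x
    using that D0 by (auto simp: s_def D_def F_def flat_def)
  have s0: "s x = 0" if "x \<le> 0" for x
    using that by (auto simp: s_def F_def flat_def)
  have "{x. c x \<noteq> 0} \<subseteq> {- (r + 1)..r + 1}"
  proof
    fix x assume "x \<in> {x. c x \<noteq> 0}"
    then have "\<not> (-1) * x + (r + 1) \<le> 0" "\<not> 1 * x + (r + 1) \<le> 0"
      using s0 by (auto simp: c_def)
    then show "x \<in> {- (r + 1)..r + 1}" by auto
  qed
  then have "bounded {x. c x \<noteq> 0}" using bounded_closed_interval bounded_subset by blast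
  then have "test_fun c" using c by (simp add: test_fun_def smooth_def)
  moreover have "c x = 1" if "\<bar>x\<bar> < r" for x
    using that s1[of "r + 1 - x"] s1[of "x + (r + 1)"] by (simp add: c_def)
  ultimately show ?thesis using that by blast
qed

lemma test_fun_iff: "test_fun f \<longleftrightarrow> smooth f \<and> bounded {x. f x \<noteq> 0}"
  by (simp add: test_fun_def smooth_def)

lemma test_fun_mult: "test_fun f \<Longrightarrow> smooth g \<Longrightarrow> test_fun (\<lambda>x. f x * g x)"
  unfolding test_fun_iff using bounded_subset[of "{x. f x \<noteq> 0}" "{x. f x * g x \<noteq> 0}"]
  by (auto intro: smooth_mult)

lemma test_fun_mult': "smooth f \<Longrightarrow> test_fun g \<Longrightarrow> test_fun (\<lambda>x. f x * g x)"
  using test_fun_mult[of g f] by (simp add: mult.commute)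

lemma test_fun_add: "test_fun f \<Longrightarrow> test_fun g \<Longrightarrow> test_fun (\<lambda>x. f x + g x)"
proof -
  assume fg: "test_fun f" "test_fun g"
  have "bounded ({x. f x \<noteq> 0} \<union> {x. g x \<noteq> 0})"
    using fg by (simp add: test_fun_iff)
  then have "bounded {x. f x + g x \<noteq> 0}"
    by (rule bounded_subset) auto
  then show ?thesis
    using smooth_add[of f g] fg by (simp add: test_fun_iff)
qed

lemma test_fun_cmult: "test_fun f \<Longrightarrow> test_fun (\<lambda>x. c * f x)"
  by (intro test_fun_mult' smooth_const)

lemma test_fun_uminus: "test_fun f \<Longrightarrow> test_fun (\<lambda>x. f (- x))"
proof -
  assume f: "test_fun f"
  have "{x. f (- x) \<noteq> 0} = uminus ` {x. f x \<noteq> 0}"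
    by (auto simp: image_iff) (metis minus_minus)
  then show ?thesis
    using f smooth_affine[of f "-1" 0] unfolding test_fun_iff by simp
qed

section \<open>Functionals of finite order and their extension to all smooth functions\<close>

text \<open>The C^N norm on [-r,r] as a relation with its bound, which avoids suprema.\<close>

definition deriv_bound :: "real \<Rightarrow> nat \<Rightarrow> real \<Rightarrow> (real \<Rightarrow> complex) \<Rightarrow> bool" where
  "deriv_bound r N M f \<longleftrightarrow> (\<forall>k\<le>N. \<forall>x. \<bar>x\<bar> \<le> r \<longrightarrow> norm ((vderiv ^^ k) f x) \<le> M)"

lemma deriv_bound_mono: "deriv_bound r N M f \<Longrightarrow> r' \<le> r \<Longrightarrow> N' \<le> N \<Longrightarrow> M \<le> M' \<Longrightarrow> deriv_bound r' N' M' f"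
  unfolding deriv_bound_def by (meson order_trans)

lemma deriv_bound_nonneg: "deriv_bound r N M f \<Longrightarrow> 0 \<le> r \<Longrightarrow> 0 \<le> M"
  unfolding deriv_bound_def using norm_ge_zero order_trans by (metis abs_zero le0)

text \<open>Equality is required on an open interval around [-r,r], so that all derivatives agree at
  the endpoints too.\<close>

lemma deriv_bound_cong:
  assumes "deriv_bound r N M f" "\<And>x. \<bar>x\<bar> < r + 1 \<Longrightarrow> f x = g x"
  shows "deriv_bound r N M g"
  unfolding deriv_bound_def
proof (intro allI impI)
  fix k x assume k: "k \<le> N" and x: "\<bar>x\<bar> \<le> r"
  have "(vderiv ^^ k) f x = (vderiv ^^ k) g x"
    by (rule vderiv_funpow_cong_open[of "{- (r + 1)<..<r + 1}"]) (use x assms(2) in auto)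
  then show "norm ((vderiv ^^ k) g x) \<le> M"
    using assms(1) k x unfolding deriv_bound_def by metis
qed

text \<open>Continuous linear functionals of finite order supported in \<open>[-r, r]\<close>, on the space of
  functions satisfying \<open>P\<close> (test functions or all smooth functions).\<close>

definition cont_functional :: "((real \<Rightarrow> complex) \<Rightarrow> bool) \<Rightarrow> real \<Rightarrow> distr \<Rightarrow> bool" where
  "cont_functional P r T \<longleftrightarrow>
     (\<forall>f g. P f \<longrightarrow> P g \<longrightarrow> T (\<lambda>x. f x + g x) = T f + T g) \<and>
     (\<forall>c f. P f \<longrightarrow> T (\<lambda>x. c * f x) = c * T f) \<and>
     (\<exists>N C. 0 \<le> C \<and> (\<forall>f M. P f \<longrightarrow> deriv_bound r N M f \<longrightarrow> norm (T f) \<le> C * M))"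

lemma cont_functional_add:
  "cont_functional P r T \<Longrightarrow> P f \<Longrightarrow> P g \<Longrightarrow> T (\<lambda>x. f x + g x) = T f + T g"
  by (simp add: cont_functional_def)

lemma cont_functional_cmult:
  "cont_functional P r T \<Longrightarrow> P f \<Longrightarrow> T (\<lambda>x. c * f x) = c * T f"
  by (simp add: cont_functional_def)

lemma cont_functional_diff:
  assumes "cont_functional P r T" "P f" "P g" "P (\<lambda>x. (-1) * g x)"
  shows "T (\<lambda>x. f x - g x) = T f - T g"
  using cont_functional_add[OF assms(1,2,4)] cont_functional_cmult[OF assms(1,3), of "-1"] by simp

lemma cont_functional_bound:
  assumes "cont_functional P r T"
  obtains C N where "0 \<le> C" "\<forall>f M. P f \<longrightarrow> deriv_bound r N M f \<longrightarrow> norm (T f) \<le> C * M"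
  using assms unfolding cont_functional_def by blast

lemma cont_functional_sum:
  assumes "cont_functional smooth r T" "\<And>i. i \<in> I \<Longrightarrow> smooth (f i)"
  shows "T (\<lambda>x. \<Sum>i\<in>I. f i x) = (\<Sum>i\<in>I. T (f i))"
proof -
  have T0: "T (\<lambda>_. 0) = 0"
    using cont_functional_cmult[OF assms(1) smooth_const[of 0], of 0] by simp
  show ?thesis
    using assms(2)
  proof (induction I rule: infinite_finite_induct)
    case (insert i I)
    have "T (\<lambda>x. \<Sum>i\<in>insert i I. f i x) = T (\<lambda>x. f i x + (\<Sum>i\<in>I. f i x))"
      using insert by simp
    also have "\<dots> = T (f i) + T (\<lambda>x. \<Sum>i\<in>I. f i x)"
      using insert by (intro cont_functional_add[OF assms(1)] smooth_sum) auto
    finally show ?case using insert by simp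
  qed (use T0 in auto)
qed

text \<open>The difference of the two functions vanishes near [-r,r], so it satisfies
  \<open>deriv_bound\<close> with M = 0 and the functional kills it. As \<open>P\<close> is
  abstract, the closure properties used appear as assumptions.\<close>

lemma cont_functional_cong:
  assumes T: "cont_functional P r T" and "P f" "P g" "P (\<lambda>x. (-1) * g x)" "P (\<lambda>x. f x - g x)"
    and eq: "\<And>x. \<bar>x\<bar> < r + 1 \<Longrightarrow> f x = g x"
  shows "T f = T g"
proof -
  obtain C N where CN: "0 \<le> C" "\<forall>f M. P f \<longrightarrow> deriv_bound r N M f \<longrightarrow> norm (T f) \<le> C * M"
    using cont_functional_bound[OF T] by blast
  note NC = CN(1) CN(2)[rule_format]
  have "deriv_bound r N 0 (\<lambda>x. f x - g x)"
    by (rule deriv_bound_cong[of _ _ _ "\<lambda>_. 0"]) (auto simp: deriv_bound_def vderiv_funpow_const eq)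
  from NC(2)[OF assms(5) this] show ?thesis
    using cont_functional_diff[OF T assms(2-4)] by simp
qed

lemma test_fun_diff: "test_fun f \<Longrightarrow> test_fun g \<Longrightarrow> test_fun (\<lambda>x. f x - g x)"
  using test_fun_add[of f, OF _ test_fun_cmult[of g "-1"]] by simp

lemma cont_functional_cong_test:
  assumes "cont_functional test_fun r T" "test_fun f" "test_fun g" "\<And>x. \<bar>x\<bar> < r + 1 \<Longrightarrow> f x = g x"
  shows "T f = T g"
  by (rule cont_functional_cong[OF assms(1-3) test_fun_cmult[OF assms(3)]
        test_fun_diff[OF assms(2,3)] assms(4)])

lemma cont_functional_cong_smooth:
  assumes "cont_functional smooth r T" "smooth f" "smooth g" "\<And>x. \<bar>x\<bar> < r + 1 \<Longrightarrow> f x = g x"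
  shows "T f = T g"
  by (rule cont_functional_cong[OF assms(1-3) smooth_cmult[OF assms(3)]
        smooth_diff[OF assms(2,3)] assms(4)])

lemma cont_functional_smooth_imp_test:
  "cont_functional smooth r T \<Longrightarrow> cont_functional test_fun r T"
  unfolding cont_functional_def by (meson test_fun_smooth)

text \<open>Makes the choice inside \<open>ext_pair\<close> meaningful: a bump equal to 1 near
  [-r,r] is a cutoff, since (1 - c) times any test function vanishes there.\<close>

lemma cutoff_exists:
  assumes B: "cont_functional test_fun r B"
  shows "cutoff_for B (SOME c. cutoff_for B c)"
proof -
  obtain c where c: "test_fun c" "\<forall>x. \<bar>x\<bar> < r + 1 \<longrightarrow> c x = 1"
    using bump_exists[of "r + 1"] by blast
  have "B (\<lambda>x. (1 - c x) * \<psi> x) = 0" if "test_fun \<psi>" for \<psi>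
  proof -
    have "B (\<lambda>x. (1 - c x) * \<psi> x) = B (\<lambda>x. 0 * \<psi> x)"
      using B that c
      by (intro cont_functional_cong_test[OF B] test_fun_mult' smooth_diff test_fun_smooth smooth_const) auto
    also have "\<dots> = 0" using cont_functional_cmult[OF B that, of 0] by simp
    finally show ?thesis .
  qed
  then have "cutoff_for B c" using c by (simp add: cutoff_for_def)
  then show ?thesis by (rule someI[of "cutoff_for B"])
qed

lemma ext_pair_test:
  assumes B: "cont_functional test_fun r B" and \<psi>: "test_fun \<psi>"
  shows "ext_pair B \<psi> = B \<psi>"
proof -
  define c where "c = (SOME c. cutoff_for B c)"
  have c: "test_fun c" "B (\<lambda>x. (1 - c x) * \<psi> x) = 0"
    using cutoff_exists[OF B] \<psi> by (auto simp: cutoff_for_def c_def)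
  have "B (\<lambda>x. \<psi> x - c x * \<psi> x) = B \<psi> - B (\<lambda>x. c x * \<psi> x)"
    using c \<psi> by (intro cont_functional_diff[OF B] test_fun_mult' test_fun_cmult test_fun_smooth)
  moreover have "(\<lambda>x. \<psi> x - c x * \<psi> x) = (\<lambda>x. (1 - c x) * \<psi> x)" by (simp add: algebra_simps)
  ultimately show ?thesis using c by (simp add: ext_pair_def c_def)
qed

text \<open>Replaces the unspecified cutoff c' by any explicit bump c. The defining property of c'
  concerns test functions only, and f need not be one; but c' f agrees with c' (c f) near [-r,r],
  and c f is a test function, so the property applies to it.\<close>

lemma ext_pair_eq_bump:
  assumes B: "cont_functional test_fun r B" and f: "smooth f"
    and c: "test_fun c" "\<forall>x. \<bar>x\<bar> < r + 1 \<longrightarrow> c x = 1"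
  shows "ext_pair B f = B (\<lambda>x. c x * f x)"
proof -
  define c' where "c' = (SOME c. cutoff_for B c)"
  have c': "test_fun c'"
    using cutoff_exists[OF B] by (auto simp: cutoff_for_def c'_def)
  have "ext_pair B f = B (\<lambda>x. c' x * f x)" by (simp add: ext_pair_def c'_def)
  also have "\<dots> = B (\<lambda>x. c' x * (c x * f x))"
    by (intro cont_functional_cong_test[OF B] test_fun_mult c' f smooth_mult test_fun_smooth[OF c(1)])
      (simp add: c)
  also have "\<dots> = ext_pair B (\<lambda>x. c x * f x)" by (simp add: ext_pair_def c'_def)
  also have "\<dots> = B (\<lambda>x. c x * f x)"
    by (intro ext_pair_test[OF B] test_fun_mult c f)
  finally show ?thesis .
qed

text \<open>Multiplication by a bump that is 1 near [-r,r] does not change the derivatives on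
  [-r,r], so order and constant of \<open>B\<close> are inherited.\<close>

lemma cont_functional_ext_pair:
  assumes B: "cont_functional test_fun r B"
  shows "cont_functional smooth r (ext_pair B)"
proof -
  obtain c where c: "test_fun c" "\<forall>x. \<bar>x\<bar> < r + 1 \<longrightarrow> c x = 1"
    using bump_exists[of "r + 1"] by blast
  note eq = ext_pair_eq_bump[OF B _ c]
  obtain C N where CN: "0 \<le> C" "\<forall>f M. test_fun f \<longrightarrow> deriv_bound r N M f \<longrightarrow> norm (B f) \<le> C * M"
    using cont_functional_bound[OF B] by blast
  note NC = CN(1) CN(2)[rule_format]
  show ?thesis
    unfolding cont_functional_def
  proof (intro conjI allI impI exI[of _ N] exI[of _ C] NC(1))
    fix f g assume fg: "smooth f" "smooth g"
    have "B (\<lambda>x. c x * f x + c x * g x) = B (\<lambda>x. c x * f x) + B (\<lambda>x. c x * g x)"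
      by (intro cont_functional_add[OF B] test_fun_mult c fg)
    then show "ext_pair B (\<lambda>x. f x + g x) = ext_pair B f + ext_pair B g"
      using fg by (simp add: eq smooth_add distrib_left)
  next
    fix a f assume f: "smooth f"
    have "B (\<lambda>x. a * (c x * f x)) = a * B (\<lambda>x. c x * f x)"
      by (intro cont_functional_cmult[OF B] test_fun_mult c f)
    then show "ext_pair B (\<lambda>x. a * f x) = a * ext_pair B f"
      using f by (simp add: eq smooth_cmult mult_ac)
  next
    fix f M assume f: "smooth f" "deriv_bound r N M f"
    have "deriv_bound r N M (\<lambda>x. c x * f x)"
      using f(2) by (rule deriv_bound_cong) (simp add: c)
    then show "norm (ext_pair B f) \<le> C * M"
      using NC(2)[OF test_fun_mult[OF c(1) f(1)]] by (simp add: eq f)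
  qed
qed

text \<open>Used for the inner convolution, which is already a functional on all smooth functions
  but is wrapped in \<open>ext_pair\<close> once more by \<open>mconv\<close>.\<close>

lemma ext_pair_smooth:
  assumes B: "cont_functional smooth r B" and f: "smooth f"
  shows "ext_pair B f = B f"
proof -
  obtain c where c: "test_fun c" "\<forall>x. \<bar>x\<bar> < r + 1 \<longrightarrow> c x = 1"
    using bump_exists[of "r + 1"] by blast
  have "ext_pair B f = B (\<lambda>x. c x * f x)"
    by (rule ext_pair_eq_bump[OF cont_functional_smooth_imp_test[OF B] f c])
  also have "\<dots> = B f"
    by (intro cont_functional_cong_smooth[OF B] smooth_mult f test_fun_smooth[OF c(1)])
      (simp add: c)
  finally show ?thesis .
qed

lemma cont_functional_reflect:
  assumes B: "cont_functional test_fun r B"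
  shows "cont_functional test_fun r (reflect B)"
proof -
  obtain C N where CN: "0 \<le> C" "\<forall>f M. test_fun f \<longrightarrow> deriv_bound r N M f \<longrightarrow> norm (B f) \<le> C * M"
    using cont_functional_bound[OF B] by blast
  note NC = CN(1) CN(2)[rule_format]
  show ?thesis
    unfolding cont_functional_def reflect_def
  proof (intro conjI allI impI exI[of _ N] exI[of _ C] NC)
    fix f M assume f: "test_fun f" "deriv_bound r N M f"
    show "deriv_bound r N M (\<lambda>u. f (- u))"
      using vderiv_funpow_affine[OF test_fun_smooth[OF f(1)], of _ "-1" 0] f(2)
      by (simp add: deriv_bound_def norm_mult norm_power)
  qed (auto intro: test_fun_uminus cont_functional_add[OF B] cont_functional_cmult[OF B])
qed

section \<open>Convolutions, moments and polynomial approximation\<close>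

text \<open>Uniform continuity on the compact set [y-1,y+1] x [-r,r]. Stating it with
  \<open>eventually\<close> lets the finitely many orders k <= N be combined into one radius
  d.\<close>

lemma uniform_on_strip:
  fixes F :: "real \<Rightarrow> real \<Rightarrow> complex"
  assumes "continuous_on UNIV (\<lambda>(y, u). F y u)" "0 < e"
  shows "\<forall>\<^sub>F d in at_right 0. \<forall>y' u. \<bar>y' - y\<bar> < d \<longrightarrow> \<bar>u\<bar> \<le> r \<longrightarrow> norm (F y' u - F y u) \<le> e"
proof -
  define K where "K = {y - 1..y + 1} \<times> {-r..r}"
  have "compact K" unfolding K_def by (intro compact_Times compact_Icc)
  then have "uniformly_continuous_on K (\<lambda>(y, u). F y u)"
    using assms(1) continuous_on_subset by (intro compact_uniformly_continuous) blast+
  then obtain d where d: "d > 0" "\<forall>p\<in>K. \<forall>p'\<in>K. dist p' p < d \<longrightarrow>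
      dist (case p' of (y, u) \<Rightarrow> F y u) (case p of (y, u) \<Rightarrow> F y u) < e"
    using assms(2) unfolding uniformly_continuous_on_def by blast
  have "\<forall>y' u. \<bar>y' - y\<bar> < d' \<longrightarrow> \<bar>u\<bar> \<le> r \<longrightarrow> norm (F y' u - F y u) \<le> e" if "d' < min d 1" for d'
  proof (intro allI impI)
    fix y' u assume *: "\<bar>y' - y\<bar> < d'" "\<bar>u\<bar> \<le> r"
    have "dist (y', u) (y, u) < d"
      using * that by (simp add: dist_Pair_Pair dist_real_def)
    moreover have "(y', u) \<in> K" "(y, u) \<in> K" using * that by (auto simp: K_def)
    ultimately show "norm (F y' u - F y u) \<le> e" using d(2) by (force simp: dist_norm)
  qed
  then show ?thesis
    using d(1) unfolding eventually_at_right_field by (intro exI[of _ "min d 1"]) auto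
qed

text \<open>The difference quotients of \<open>\<Phi>\<close> converge to \<open>\<Phi>'\<close>
  together with N derivatives in u, uniformly on [-r,r], and \<open>T\<close> is bounded in exactly
  that norm.\<close>

lemma cont_functional_has_vector_derivative:
  assumes T: "cont_functional smooth r T"
    and sm: "\<And>y. smooth (\<Phi> y)" "\<And>y. smooth (\<Phi>' y)"
    and der: "\<And>k y u. ((\<lambda>y. (vderiv ^^ k) (\<Phi> y) u) has_vector_derivative (vderiv ^^ k) (\<Phi>' y) u) (at y)"
    and cont: "\<And>k. continuous_on UNIV (\<lambda>(y, u). (vderiv ^^ k) (\<Phi>' y) u)"
  shows "((\<lambda>y. T (\<Phi> y)) has_vector_derivative T (\<Phi>' y)) (at y)"
proof -
  obtain C N where CN: "0 \<le> C" "\<forall>f M. smooth f \<longrightarrow> deriv_bound r N M f \<longrightarrow> norm (T f) \<le> C * M"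
    using cont_functional_bound[OF T] by blast
  have "\<exists>d>0. \<forall>y'. norm (y' - y) < d \<longrightarrow>
      norm (T (\<Phi> y') - T (\<Phi> y) - (y' - y) *\<^sub>R T (\<Phi>' y)) \<le> e * norm (y' - y)" if e: "e > 0" for e
  proof -
    \<comment> \<open>The denominator is C + 1 because C may be 0.\<close>
    define e' where "e' = e / (C + 1)"
    have e': "e' > 0" "C * e' \<le> e" using e CN(1) by (auto simp: e'_def field_simps)
    have "\<forall>\<^sub>F d in at_right 0. \<forall>k\<in>{..N}. \<forall>y' u. \<bar>y' - y\<bar> < d \<longrightarrow> \<bar>u\<bar> \<le> r \<longrightarrow>
        norm ((vderiv ^^ k) (\<Phi>' y') u - (vderiv ^^ k) (\<Phi>' y) u) \<le> e'"
      using uniform_on_strip[OF cont e'(1)] by (intro eventually_ball_finite) auto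
    then have "\<forall>\<^sub>F d in at_right 0. (0::real) < d \<and> (\<forall>k\<in>{..N}. \<forall>y' u. \<bar>y' - y\<bar> < d \<longrightarrow> \<bar>u\<bar> \<le> r \<longrightarrow>
        norm ((vderiv ^^ k) (\<Phi>' y') u - (vderiv ^^ k) (\<Phi>' y) u) \<le> e')"
      using eventually_at_right_less by eventually_elim auto
    then obtain d where d: "d > 0" "\<forall>k\<in>{..N}. \<forall>y' u. \<bar>y' - y\<bar> < d \<longrightarrow> \<bar>u\<bar> \<le> r \<longrightarrow>
        norm ((vderiv ^^ k) (\<Phi>' y') u - (vderiv ^^ k) (\<Phi>' y) u) \<le> e'"
      using eventually_happens' trivial_limit_at_right_real by (metis (no_types, lifting))
    have "norm (T (\<Phi> y') - T (\<Phi> y) - (y' - y) *\<^sub>R T (\<Phi>' y)) \<le> e * norm (y' - y)"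
      if y': "norm (y' - y) < d" for y'
    proof -
      define h where "h = complex_of_real (y' - y)"
      note s = smooth_diff[OF smooth_diff[OF sm(1)[of y'] sm(1)[of y]] smooth_cmult[OF sm(2)[of y], of h]]
      have "deriv_bound r N (e' * \<bar>y' - y\<bar>) (\<lambda>u. \<Phi> y' u - \<Phi> y u - h * \<Phi>' y u)"
        unfolding deriv_bound_def
      proof (intro allI impI)
        fix k u assume k: "k \<le> N" and u: "\<bar>u\<bar> \<le> r"
        \<comment> \<open>Mean value inequality in y, with u and k fixed; the bound e' does not
          depend on u, which yields an estimate of the whole remainder.\<close>
        have "norm ((vderiv ^^ k) (\<Phi> y') u - (vderiv ^^ k) (\<Phi> y) u - (y' - y) *\<^sub>R (vderiv ^^ k) (\<Phi>' y) u)
            \<le> norm (y' - y) * e'"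
        proof (rule vector_differentiable_bound_linearization[where f = "\<lambda>y. (vderiv ^^ k) (\<Phi> y) u"
              and f' = "\<lambda>y. (vderiv ^^ k) (\<Phi>' y) u" and S = "closed_segment y y'"])
          fix x assume x: "x \<in> closed_segment y y'"
          then have "\<bar>x - y\<bar> < d" using y' by (auto simp: closed_segment_eq_real_ivl split: if_splits)
          then show "norm ((vderiv ^^ k) (\<Phi>' x) u - (vderiv ^^ k) (\<Phi>' y) u) \<le> e'"
            using d(2) k u by blast
        qed (auto intro: has_vector_derivative_at_within der)
        moreover have "(vderiv ^^ k) (\<lambda>u. \<Phi> y' u - \<Phi> y u - h * \<Phi>' y u) u =
            (vderiv ^^ k) (\<Phi> y') u - (vderiv ^^ k) (\<Phi> y) u - (y' - y) *\<^sub>R (vderiv ^^ k) (\<Phi>' y) u"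
          unfolding vderiv_funpow_diff[OF smooth_diff[OF sm(1) sm(1)] smooth_cmult[OF sm(2)]]
            vderiv_funpow_diff[OF sm(1) sm(1)] vderiv_funpow_cmult[OF sm(2)]
          by (simp add: h_def scaleR_conv_of_real)
        ultimately show "norm ((vderiv ^^ k) (\<lambda>u. \<Phi> y' u - \<Phi> y u - h * \<Phi>' y u) u) \<le> e' * \<bar>y' - y\<bar>"
          by (simp add: mult.commute)
      qed
      then have "norm (T (\<lambda>u. \<Phi> y' u - \<Phi> y u - h * \<Phi>' y u)) \<le> C * (e' * \<bar>y' - y\<bar>)"
        using CN(2) s by blast
      also have "T (\<lambda>u. \<Phi> y' u - \<Phi> y u - h * \<Phi>' y u) = T (\<lambda>u. \<Phi> y' u - \<Phi> y u) - T (\<lambda>u. h * \<Phi>' y u)"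
        by (intro cont_functional_diff[OF T] smooth_diff smooth_cmult sm)
      also have "T (\<lambda>u. \<Phi> y' u - \<Phi> y u) = T (\<Phi> y') - T (\<Phi> y)"
        by (intro cont_functional_diff[OF T] smooth_cmult sm)
      also have "T (\<lambda>u. h * \<Phi>' y u) = (y' - y) *\<^sub>R T (\<Phi>' y)"
        using cont_functional_cmult[OF T sm(2)] by (simp add: h_def scaleR_conv_of_real)
      also have "C * (e' * \<bar>y' - y\<bar>) \<le> e * norm (y' - y)"
        using e'(2) mult_right_mono[of "C * e'" e "\<bar>y' - y\<bar>"] by (simp add: mult.assoc)
      finally show ?thesis .
    qed
    then show ?thesis using d(1) by blast
  qed
  then show ?thesis
    unfolding has_vector_derivative_def has_derivative_at_alt
    by (simp add: bounded_linear_scaleR_left)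
qed

lemma smooth_translate: "smooth f \<Longrightarrow> smooth (\<lambda>u. f (y + u))"
  using smooth_affine[of f 1 y] by (simp add: add.commute)

lemma vderiv_funpow_translate:
  "smooth f \<Longrightarrow> (vderiv ^^ k) (\<lambda>u. f (y + u)) = (\<lambda>u. (vderiv ^^ k) f (y + u))"
  using vderiv_funpow_affine[of f k 1 y] by (simp add: add.commute)

lemma cont_functional_translate_deriv:
  assumes T: "cont_functional smooth r T" and f: "smooth f"
  shows "((\<lambda>y. T (\<lambda>u. f (y + u))) has_vector_derivative T (\<lambda>u. vderiv f (y + u))) (at y)"
proof (rule cont_functional_has_vector_derivative[OF T])
  fix k y u
  have "((\<lambda>y. (vderiv ^^ k) f (1 * y + u)) has_vector_derivative of_real 1 * (vderiv ^^ Suc k) f (1 * y + u)) (at y)"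
    by (intro has_vector_derivative_affine smooth_funpow_deriv f)
  then show "((\<lambda>y. (vderiv ^^ k) (\<lambda>u. f (y + u)) u) has_vector_derivative
      (vderiv ^^ k) (\<lambda>u. vderiv f (y + u)) u) (at y)"
    unfolding vderiv_funpow_translate[OF f] vderiv_funpow_translate[OF smooth_vderiv[OF f]]
    by (simp add: funpow_swap1)
next
  fix k
  have "continuous_on UNIV (\<lambda>p. (vderiv ^^ Suc k) f (fst p + snd p))"
    by (intro continuous_on_compose2[OF smooth_funpow_continuous_on[OF f, of UNIV]] continuous_intros) auto
  then show "continuous_on UNIV (\<lambda>(y, u). (vderiv ^^ k) (\<lambda>u. vderiv f (y + u)) u)"
    unfolding vderiv_funpow_translate[OF smooth_vderiv[OF f]]
    by (simp add: funpow_swap1 case_prod_unfold)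
qed (intro smooth_translate smooth_vderiv f)+

lemma cont_functional_translate:
  assumes T: "cont_functional smooth r T" and f: "smooth f"
  shows "smooth (\<lambda>y. T (\<lambda>u. f (y + u)))"
    and "(vderiv ^^ k) (\<lambda>y. T (\<lambda>u. f (y + u))) = (\<lambda>y. T (\<lambda>u. (vderiv ^^ k) f (y + u)))"
proof -
  let ?X = "\<lambda>g. \<exists>f. smooth f \<and> g = (\<lambda>y. T (\<lambda>u. f (y + u)))"
  have "?X (\<lambda>y. T (\<lambda>u. f (y + u)))" using f by blast
  then show "smooth (\<lambda>y. T (\<lambda>u. f (y + u)))"
  proof (rule smooth_coinduct)
    fix g assume "?X g"
    then obtain f where f: "smooth f" "g = (\<lambda>y. T (\<lambda>u. f (y + u)))" by blast
    show "\<exists>g'. ?X g' \<and> (\<forall>x. (g has_vector_derivative g' x) (at x))"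
      unfolding f(2)
      by (intro exI[of _ "\<lambda>y. T (\<lambda>u. vderiv f (y + u))"] conjI exI[of _ "vderiv f"] refl allI
          smooth_vderiv f(1) cont_functional_translate_deriv[OF T])
  qed
  show "(vderiv ^^ k) (\<lambda>y. T (\<lambda>u. f (y + u))) = (\<lambda>y. T (\<lambda>u. (vderiv ^^ k) f (y + u)))"
  proof (induction k)
    case (Suc k)
    show ?case
      unfolding funpow.simps o_apply Suc
      using cont_functional_translate_deriv[OF T smooth_funpow[OF f]] by (intro vderivI)
  qed simp
qed

section \<open>Dilations u -> y u, needed for multiplicative convolution\<close>

text \<open>Differentiating u^j f(y u) in y gives u^(j+1) f'(y u), so with the factor u^j the family
  is stable under differentiation in the parameter.\<close>

definition scaled :: "nat \<Rightarrow> (real \<Rightarrow> complex) \<Rightarrow> real \<Rightarrow> real \<Rightarrow> complex" where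
  "scaled j f y = (\<lambda>u. of_real u ^ j * f (y * u))"

lemma smooth_scaled: "smooth f \<Longrightarrow> smooth (scaled j f y)"
  unfolding scaled_def using smooth_affine[of f y 0]
  by (intro smooth_mult smooth_power smooth_ident) simp

text \<open>For j = 0 the truncated \<open>j - 1\<close> is harmless, its term having the factor
  \<open>of_nat j\<close> = 0.\<close>

lemma vderiv_scaled:
  assumes f: "smooth f"
  shows "vderiv (scaled j f y) = (\<lambda>u. of_nat j * scaled (j - 1) f y u + of_real y * scaled j (vderiv f) y u)"
proof (rule vderivI)
  fix u
  have 1: "((\<lambda>u. f (y * u + 0)) has_vector_derivative of_real y * vderiv f (y * u + 0)) (at u)"
    by (intro has_vector_derivative_affine smooth_deriv f)
  have "((\<lambda>u. u ^ j) has_real_derivative of_nat j * u ^ (j - 1)) (at u)"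
    by (auto intro!: derivative_eq_intros)
  then have 2: "((\<lambda>u. complex_of_real (u ^ j)) has_vector_derivative of_real (of_nat j * u ^ (j - 1))) (at u)"
    by (intro has_vector_derivative_of_real) (simp add: has_real_derivative_iff_has_vector_derivative)
  show "(scaled j f y has_vector_derivative
      of_nat j * scaled (j - 1) f y u + of_real y * scaled j (vderiv f) y u) (at u)"
    using has_vector_derivative_mult[OF 2 1] by (simp add: scaled_def algebra_simps)
qed

text \<open>Lowers the order in u by one at the price of changing \<open>j\<close> and
  \<open>f\<close>; this recursion drives the following inductions, which therefore generalize over
  both.\<close>

lemma vderiv_funpow_scaled:
  assumes f: "smooth f"
  shows "(vderiv ^^ Suc k) (scaled j f y) u =
    of_nat j * (vderiv ^^ k) (scaled (j - 1) f y) u + of_real y * (vderiv ^^ k) (scaled j (vderiv f) y) u"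
  unfolding funpow_Suc_right o_apply vderiv_scaled[OF f]
    vderiv_funpow_add[OF smooth_cmult[OF smooth_scaled[OF f]] smooth_cmult[OF smooth_scaled[OF smooth_vderiv[OF f]]]]
    vderiv_funpow_cmult[OF smooth_scaled[OF f]] vderiv_funpow_cmult[OF smooth_scaled[OF smooth_vderiv[OF f]]] ..

lemma scaled_deriv:
  assumes "smooth f"
  shows "((\<lambda>y. (vderiv ^^ k) (scaled j f y) u) has_vector_derivative
    (vderiv ^^ k) (scaled (Suc j) (vderiv f) y) u) (at y)"
  using assms
proof (induction k arbitrary: j f)
  case 0
  have "((\<lambda>y. f (u * y + 0)) has_vector_derivative of_real u * vderiv f (u * y + 0)) (at y)"
    by (intro has_vector_derivative_affine smooth_deriv 0)
  from has_vector_derivative_mult_right[OF this, of "of_real u ^ j"]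
  show ?case by (simp add: scaled_def mult_ac)
next
  case (Suc k)
  have "(of_real has_vector_derivative (1::complex)) (at y)"
    by (rule has_vector_derivative_complex_of_real)
  note d = has_vector_derivative_add[OF has_vector_derivative_mult_right[OF Suc.IH[OF Suc.prems, of "j - 1"], of "of_nat j"]
      has_vector_derivative_mult[OF this Suc.IH[OF smooth_vderiv[OF Suc.prems], of j]]]
  show ?case
    unfolding vderiv_funpow_scaled[OF Suc.prems] vderiv_funpow_scaled[OF smooth_vderiv[OF Suc.prems]]
    \<comment> \<open>The case split removes the truncated subtraction: \<open>Suc j - 1\<close>
      against \<open>Suc (j - 1)\<close>.\<close>
    using d by (cases j) (simp_all add: algebra_simps)
qed

lemma scaled_continuous:
  assumes "smooth f"
  shows "continuous_on UNIV (\<lambda>(y, u). (vderiv ^^ k) (scaled j f y) u)"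
  using assms
proof (induction k arbitrary: j f)
  case 0
  have "continuous_on UNIV (\<lambda>p::real \<times> real. of_real (snd p) ^ j * f (fst p * snd p))"
    by (intro continuous_intros continuous_on_compose2[OF smooth_continuous_on[OF 0, of UNIV]]) auto
  then show ?case by (simp add: scaled_def case_prod_unfold)
next
  case (Suc k)
  have "continuous_on UNIV (\<lambda>p. of_nat j * (vderiv ^^ k) (scaled (j - 1) f (fst p)) (snd p) +
      of_real (fst p) * (vderiv ^^ k) (scaled j (vderiv f) (fst p)) (snd p))"
    using Suc.IH[OF Suc.prems] Suc.IH[OF smooth_vderiv[OF Suc.prems]]
    by (intro continuous_intros) (simp_all add: case_prod_unfold)
  then show ?case
    unfolding vderiv_funpow_scaled[OF Suc.prems] by (simp add: case_prod_unfold)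
qed

text \<open>Since |y u| <= R r, only derivatives of f on [-R r, R r] occur. The point is that C
  depends on k, j, R and r but not on f, y or u.\<close>

lemma scaled_bound:
  assumes "0 \<le> R" "0 \<le> r"
  shows "\<exists>C\<ge>0. \<forall>f M y u. smooth f \<longrightarrow> deriv_bound (R * r) k M f \<longrightarrow> \<bar>y\<bar> \<le> R \<longrightarrow> \<bar>u\<bar> \<le> r \<longrightarrow>
    norm ((vderiv ^^ k) (scaled j f y) u) \<le> C * M"
proof (induction k arbitrary: j)
  case 0
  have "norm (scaled j f y u) \<le> r ^ j * M"
    if "deriv_bound (R * r) 0 M f" "\<bar>y\<bar> \<le> R" "\<bar>u\<bar> \<le> r" for f M y u
  proof -
    have "\<bar>y * u\<bar> \<le> R * r"
      unfolding abs_mult using that assms by (intro mult_mono) auto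
    then have "norm (f (y * u)) \<le> M"
      using that(1) by (simp add: deriv_bound_def)
    moreover have "\<bar>u\<bar> ^ j \<le> r ^ j" using that by (intro power_mono) auto
    ultimately show ?thesis
      unfolding scaled_def norm_mult norm_power using assms
      by (intro mult_mono) auto
  qed
  then show ?case using assms by (intro exI[of _ "r ^ j"]) auto
next
  case (Suc k)
  obtain C1 C2 where C: "C1 \<ge> 0" "C2 \<ge> 0"
    "\<forall>f M y u. smooth f \<longrightarrow> deriv_bound (R * r) k M f \<longrightarrow> \<bar>y\<bar> \<le> R \<longrightarrow> \<bar>u\<bar> \<le> r \<longrightarrow>
      norm ((vderiv ^^ k) (scaled (j - 1) f y) u) \<le> C1 * M"
    "\<forall>f M y u. smooth f \<longrightarrow> deriv_bound (R * r) k M f \<longrightarrow> \<bar>y\<bar> \<le> R \<longrightarrow> \<bar>u\<bar> \<le> r \<longrightarrow>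
      norm ((vderiv ^^ k) (scaled j f y) u) \<le> C2 * M"
    using Suc.IH[of "j - 1"] Suc.IH[of j] by blast
  show ?case
  proof (intro exI[of _ "of_nat j * C1 + R * C2"] conjI allI impI)
    fix f M y u assume *: "smooth f" "deriv_bound (R * r) (Suc k) M f" "\<bar>y\<bar> \<le> R" "\<bar>u\<bar> \<le> r"
    have b1: "deriv_bound (R * r) k M f" using *(2) by (simp add: deriv_bound_def)
    have b2: "deriv_bound (R * r) k M (vderiv f)"
      unfolding deriv_bound_def
    proof (intro allI impI)
      fix i x assume "i \<le> k" "\<bar>x\<bar> \<le> R * r"
      then have "norm ((vderiv ^^ Suc i) f x) \<le> M"
        using *(2) unfolding deriv_bound_def by (metis Suc_le_mono)
      then show "norm ((vderiv ^^ i) (vderiv f) x) \<le> M" by (simp add: funpow_swap1)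
    qed
    have n1: "norm ((vderiv ^^ k) (scaled (j - 1) f y) u) \<le> C1 * M"
      using C(3) * b1 by blast
    have n2: "norm ((vderiv ^^ k) (scaled j (vderiv f) y) u) \<le> C2 * M"
      using C(4) * b2 smooth_vderiv by blast
    have "norm ((vderiv ^^ Suc k) (scaled j f y) u) \<le>
        of_nat j * norm ((vderiv ^^ k) (scaled (j - 1) f y) u) + \<bar>y\<bar> * norm ((vderiv ^^ k) (scaled j (vderiv f) y) u)"
      unfolding vderiv_funpow_scaled[OF *(1)] by (rule order_trans[OF norm_triangle_ineq]) (simp add: norm_mult)
    also have "\<dots> \<le> of_nat j * (C1 * M) + R * (C2 * M)"
      using n1 n2 * assms by (intro add_mono mult_mono) auto
    finally show "norm ((vderiv ^^ Suc k) (scaled j f y) u) \<le> (of_nat j * C1 + R * C2) * M"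
      by (simp add: algebra_simps)
  qed (use C assms in auto)
qed

lemma cont_functional_scaled_deriv:
  assumes T: "cont_functional smooth r T" and f: "smooth f"
  shows "((\<lambda>y. T (scaled j f y)) has_vector_derivative T (scaled (Suc j) (vderiv f) y)) (at y)"
  by (intro cont_functional_has_vector_derivative[OF T] smooth_scaled scaled_deriv scaled_continuous smooth_vderiv f)

lemma cont_functional_scaled:
  assumes T: "cont_functional smooth r T" and f: "smooth f"
  shows "smooth (\<lambda>y. T (scaled j f y))"
    and "(vderiv ^^ k) (\<lambda>y. T (scaled j f y)) = (\<lambda>y. T (scaled (j + k) ((vderiv ^^ k) f) y))"
proof -
  let ?X = "\<lambda>g. \<exists>j f. smooth f \<and> g = (\<lambda>y. T (scaled j f y))"
  have "?X (\<lambda>y. T (scaled j f y))" using f by blast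
  then show "smooth (\<lambda>y. T (scaled j f y))"
  proof (rule smooth_coinduct)
    fix g assume "?X g"
    then obtain j f where f: "smooth f" "g = (\<lambda>y. T (scaled j f y))" by blast
    show "\<exists>g'. ?X g' \<and> (\<forall>x. (g has_vector_derivative g' x) (at x))"
      unfolding f(2)
      by (intro exI[of _ "\<lambda>y. T (scaled (Suc j) (vderiv f) y)"] conjI exI[of _ "vderiv f"] exI[of _ "Suc j"]
          refl allI smooth_vderiv f(1) cont_functional_scaled_deriv[OF T])
  qed
  show "(vderiv ^^ k) (\<lambda>y. T (scaled j f y)) = (\<lambda>y. T (scaled (j + k) ((vderiv ^^ k) f) y))"
  proof (induction k)
    case (Suc k)
    show ?case
      unfolding funpow.simps o_apply Suc add_Suc_right
      by (intro vderivI cont_functional_scaled_deriv[OF T] smooth_funpow f)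
  qed simp
qed

section \<open>Both convolutions are functionals of finite order\<close>

text \<open>The outer functional uses up to NA derivatives in y1, the inner one NB more in y2, and
  all of them fall on f at a point with |y1 + y2| <= rA + rB. Hence orders and radii add.\<close>

lemma cont_functional_conv:
  assumes A: "cont_functional test_fun rA A" and B: "cont_functional test_fun rB B"
  shows "cont_functional smooth (rA + rB) (conv A B)"
proof -
  note A' = cont_functional_ext_pair[OF A] and B' = cont_functional_ext_pair[OF B]
  obtain CA NA where CA: "0 \<le> CA" "\<forall>f M. smooth f \<longrightarrow> deriv_bound rA NA M f \<longrightarrow> norm (ext_pair A f) \<le> CA * M"
    using cont_functional_bound[OF A'] by blast
  obtain CB NB where CB: "0 \<le> CB" "\<forall>f M. smooth f \<longrightarrow> deriv_bound rB NB M f \<longrightarrow> norm (ext_pair B f) \<le> CB * M"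
    using cont_functional_bound[OF B'] by blast
  show ?thesis
    unfolding cont_functional_def
  proof (intro conjI allI impI exI[of _ "NA + NB"] exI[of _ "CA * CB"])
    fix f g assume fg: "smooth f" "smooth g"
    have "(\<lambda>y1. ext_pair B (\<lambda>y2. f (y1 + y2) + g (y1 + y2))) =
        (\<lambda>y1. ext_pair B (\<lambda>y2. f (y1 + y2)) + ext_pair B (\<lambda>y2. g (y1 + y2)))"
      by (intro ext cont_functional_add[OF B'] smooth_translate fg)
    then show "conv A B (\<lambda>x. f x + g x) = conv A B f + conv A B g"
      unfolding conv_def
      using cont_functional_add[OF A' cont_functional_translate(1)[OF B' fg(1)] cont_functional_translate(1)[OF B' fg(2)]]
      by simp
  next
    fix c f assume f: "smooth f"
    have "(\<lambda>y1. ext_pair B (\<lambda>y2. c * f (y1 + y2))) = (\<lambda>y1. c * ext_pair B (\<lambda>y2. f (y1 + y2)))"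
      by (intro ext cont_functional_cmult[OF B'] smooth_translate f)
    then show "conv A B (\<lambda>x. c * f x) = c * conv A B f"
      unfolding conv_def
      using cont_functional_cmult[OF A' cont_functional_translate(1)[OF B' f]] by simp
  next
    fix f M assume f: "smooth f" "deriv_bound (rA + rB) (NA + NB) M f"
    have "deriv_bound rA NA (CB * M) (\<lambda>y1. ext_pair B (\<lambda>y2. f (y1 + y2)))"
      unfolding deriv_bound_def cont_functional_translate(2)[OF B' f(1)]
    proof (intro allI impI)
      fix k x assume k: "k \<le> NA" and x: "\<bar>x\<bar> \<le> rA"
      have "deriv_bound rB NB M (\<lambda>u. (vderiv ^^ k) f (x + u))"
        unfolding deriv_bound_def vderiv_funpow_translate[OF smooth_funpow[OF f(1)]]
      proof (intro allI impI)
        fix l u assume "l \<le> NB" "\<bar>u\<bar> \<le> rB"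
        then show "norm ((vderiv ^^ l) ((vderiv ^^ k) f) (x + u)) \<le> M"
          using f(2) k x unfolding deriv_bound_def
          by (simp flip: funpow_add[THEN fun_cong, unfolded o_apply])
      qed
      then show "norm (ext_pair B (\<lambda>u. (vderiv ^^ k) f (x + u))) \<le> CB * M"
        using CB(2) smooth_translate[OF smooth_funpow[OF f(1)]] by blast
    qed
    then show "norm (conv A B f) \<le> CA * CB * M"
      unfolding conv_def using CA(2) cont_functional_translate(1)[OF B' f(1)] by (simp add: mult.assoc)
  qed (use CA CB in simp)
qed

lemma scaled_0: "scaled 0 f y = (\<lambda>u. f (y * u))"
  by (simp add: scaled_def)

text \<open>The k-th derivative in y1 of the inner pairing is the pairing with
  \<open>scaled k\<close> of the k-th derivative of f, which \<open>scaled_bound\<close> controls.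
  Orders add and radii multiply.\<close>

lemma cont_functional_mconv:
  assumes A: "cont_functional test_fun rA A" and B: "cont_functional test_fun rB B"
    and r: "0 \<le> rA" "0 \<le> rB"
  shows "cont_functional smooth (rA * rB) (mconv A B)"
proof -
  note A' = cont_functional_ext_pair[OF A] and B' = cont_functional_ext_pair[OF B]
  obtain CA NA where CA: "0 \<le> CA" "\<forall>f M. smooth f \<longrightarrow> deriv_bound rA NA M f \<longrightarrow> norm (ext_pair A f) \<le> CA * M"
    using cont_functional_bound[OF A'] by blast
  obtain CB NB where CB: "0 \<le> CB" "\<forall>f M. smooth f \<longrightarrow> deriv_bound rB NB M f \<longrightarrow> norm (ext_pair B f) \<le> CB * M"
    using cont_functional_bound[OF B'] by blast
  obtain D where D: "\<And>k j. D k j \<ge> 0"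
    "\<And>k j f M y u. smooth f \<Longrightarrow> deriv_bound (rA * rB) k M f \<Longrightarrow> \<bar>y\<bar> \<le> rA \<Longrightarrow> \<bar>u\<bar> \<le> rB \<Longrightarrow>
      norm ((vderiv ^^ k) (scaled j f y) u) \<le> D k j * M"
    using scaled_bound[OF r] by metis
  \<comment> \<open>One constant dominating all D k j that can occur.\<close>
  define E where "E = (\<Sum>k\<le>NB. \<Sum>j\<le>NA. D k j)"
  have E: "D k j \<le> E" if "k \<le> NB" "j \<le> NA" for k j
  proof -
    have "D k j \<le> (\<Sum>j\<le>NA. D k j)"
      by (rule member_le_sum) (use that D in auto)
    also have "\<dots> \<le> E"
      unfolding E_def by (rule member_le_sum) (use that D in \<open>auto intro: sum_nonneg\<close>)
    finally show ?thesis .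
  qed
  have E0: "0 \<le> E" unfolding E_def by (intro sum_nonneg D)
  note sc = cont_functional_scaled[OF B', where j = 0, unfolded scaled_0]
  have sm: "smooth f \<Longrightarrow> smooth (\<lambda>u. f (y * u))" for f y
    using smooth_scaled[of f 0 y] by (simp add: scaled_0)
  show ?thesis
    unfolding cont_functional_def
  proof (intro conjI allI impI exI[of _ "NA + NB"] exI[of _ "CA * (CB * E)"])
    fix f g assume fg: "smooth f" "smooth g"
    have "(\<lambda>y1. ext_pair B (\<lambda>y2. f (y1 * y2) + g (y1 * y2))) =
        (\<lambda>y1. ext_pair B (\<lambda>y2. f (y1 * y2)) + ext_pair B (\<lambda>y2. g (y1 * y2)))"
      by (intro ext cont_functional_add[OF B'] sm fg)
    then show "mconv A B (\<lambda>x. f x + g x) = mconv A B f + mconv A B g"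
      unfolding mconv_def
      using cont_functional_add[OF A' sc(1)[OF fg(1)] sc(1)[OF fg(2)]] by simp
  next
    fix c f assume f: "smooth f"
    have "(\<lambda>y1. ext_pair B (\<lambda>y2. c * f (y1 * y2))) = (\<lambda>y1. c * ext_pair B (\<lambda>y2. f (y1 * y2)))"
      by (intro ext cont_functional_cmult[OF B'] sm f)
    then show "mconv A B (\<lambda>x. c * f x) = c * mconv A B f"
      unfolding mconv_def
      using cont_functional_cmult[OF A' sc(1)[OF f]] by simp
  next
    fix f M assume f: "smooth f" "deriv_bound (rA * rB) (NA + NB) M f"
    have M: "0 \<le> M" using deriv_bound_nonneg[OF f(2)] r by simp
    have "deriv_bound rA NA (CB * (E * M)) (\<lambda>y1. ext_pair B (\<lambda>y2. f (y1 * y2)))"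
      unfolding deriv_bound_def sc(2)[OF f(1)]
    proof (intro allI impI)
      fix k x assume k: "k \<le> NA" and x: "\<bar>x\<bar> \<le> rA"
      have "deriv_bound rB NB (E * M) (scaled (0 + k) ((vderiv ^^ k) f) x)"
        unfolding deriv_bound_def
      proof (intro allI impI)
        fix l u assume l: "l \<le> NB" and u: "\<bar>u\<bar> \<le> rB"
        have "deriv_bound (rA * rB) l M ((vderiv ^^ k) f)"
          using f(2) k l unfolding deriv_bound_def
          by (simp flip: funpow_add[THEN fun_cong, unfolded o_apply])
        then have "norm ((vderiv ^^ l) (scaled (0 + k) ((vderiv ^^ k) f) x) u) \<le> D l k * M"
          using D(2)[OF smooth_funpow[OF f(1)] _ x u, of l M k k] by simp
        also have "\<dots> \<le> E * M" using E[OF l k] M by (rule mult_right_mono)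
        finally show "norm ((vderiv ^^ l) (scaled (0 + k) ((vderiv ^^ k) f) x) u) \<le> E * M" .
      qed
      then show "norm (ext_pair B (scaled (0 + k) ((vderiv ^^ k) f) x)) \<le> CB * (E * M)"
        using CB(2) smooth_scaled[OF smooth_funpow[OF f(1)]] by blast
    qed
    then show "norm (mconv A B f) \<le> CA * (CB * E) * M"
      unfolding mconv_def using CA(2) sc(1)[OF f(1)] by (simp add: mult.assoc)
  qed (use CA CB E0 in simp)
qed

section \<open>Density of polynomials in C^N, and moments of convolutions\<close>

lemma poly_has_vector_derivative:
  "((\<lambda>x. poly p (complex_of_real x)) has_vector_derivative poly (pderiv p) (complex_of_real x)) (at x)"
  using field_vector_diff_chain_at[OF has_vector_derivative_complex_of_real poly_DERIV[of p "complex_of_real x"]]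
  by (simp add: o_def)

lemma smooth_poly: "smooth (\<lambda>x. poly p (complex_of_real x))"
proof -
  let ?X = "\<lambda>f. \<exists>p. f = (\<lambda>x. poly p (complex_of_real x))"
  have "?X (\<lambda>x. poly p (complex_of_real x))" by blast
  then show ?thesis
    by (rule smooth_coinduct) (use poly_has_vector_derivative in blast)
qed

lemma pderiv_surj: "\<exists>q :: complex poly. pderiv q = p \<and> poly q 0 = c"
proof -
  define q where "q = (\<Sum>i\<le>degree p. monom (coeff p i / of_nat (Suc i)) (Suc i)) + [:c:]"
  have pderiv_sum: "pderiv (\<Sum>i\<in>I. h i) = (\<Sum>i\<in>I. pderiv (h i))" for h :: "nat \<Rightarrow> complex poly" and I
    by (induction I rule: infinite_finite_induct) (simp_all add: pderiv_add)
  have "pderiv q = (\<Sum>i\<le>degree p. monom (coeff p i) i)"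
    by (simp add: q_def pderiv_add pderiv_sum pderiv_monom pderiv_pCons del: of_nat_Suc)
  also have "\<dots> = p" by (rule poly_as_sum_of_monoms)
  finally have "pderiv q = p" .
  moreover have "poly q 0 = c" by (simp add: q_def poly_sum poly_monom)
  ultimately show ?thesis by blast
qed

lemma polynomial_function_complex:
  fixes g :: "real \<Rightarrow> complex"
  assumes "polynomial_function g"
  shows "\<exists>p. g = (\<lambda>x. poly p (complex_of_real x))"
proof -
  have *: "\<exists>p. \<forall>x. complex_of_real (h x) = poly p (complex_of_real x)" if h: "real_polynomial_function h" for h
  proof -
    from h obtain a n where "h = (\<lambda>x. \<Sum>i\<le>n. a i * x ^ i)"
      using real_polynomial_function_iff_sum by blast
    then have "\<forall>x. complex_of_real (h x) = poly (\<Sum>i\<le>n. monom (of_real (a i)) i) (complex_of_real x)"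
      by (simp add: poly_sum poly_monom)
    then show ?thesis by blast
  qed
  have "real_polynomial_function (Re \<circ> g)" "real_polynomial_function (Im \<circ> g)"
    using assms bounded_linear_Re bounded_linear_Im unfolding polynomial_function_def by blast+
  with * obtain p q where pq: "\<forall>x. complex_of_real (Re (g x)) = poly p (complex_of_real x)"
    "\<forall>x. complex_of_real (Im (g x)) = poly q (complex_of_real x)"
    by (metis comp_apply)
  have "g x = poly (p + smult \<i> q) (complex_of_real x)" for x
    using complex_eq[of "g x"] pq by simp
  then show ?thesis by blast
qed

text \<open>Induction on N: approximate f' to order N by a polynomial p and integrate, choosing the
  constant so that q(0) = f(0). The derivatives of f - q are then those of f' - p, and f - q itself
  is bounded by the mean value inequality from 0.\<close>

lemma smooth_poly_approx:
  assumes "smooth f" "0 < e" "0 \<le> r"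
  shows "\<exists>p. deriv_bound r N e (\<lambda>x. f x - poly p (complex_of_real x))"
  using assms(1,2)
proof (induction N arbitrary: f e)
  case 0
  obtain g where g: "polynomial_function g" "\<forall>x\<in>{-r..r}. norm (f x - g x) < e"
    using Stone_Weierstrass_polynomial_function[OF compact_Icc smooth_continuous_on[OF 0(1)] 0(2)] by blast
  then obtain p where "g = (\<lambda>x. poly p (complex_of_real x))"
    using polynomial_function_complex by blast
  then show ?case
    using g(2) by (intro exI[of _ p]) (auto simp: deriv_bound_def less_imp_le abs_le_iff)
next
  case (Suc N)
  \<comment> \<open>Small enough for both uses: e' <= e for the derivatives and r e' <= e for the
    function itself.\<close>
  define e' where "e' = e / (r + 1)"
  have e': "0 < e'" "e' \<le> e" "r * e' \<le> e"
    using Suc.prems assms(3) by (auto simp: e'_def field_simps)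
  obtain p where p: "deriv_bound r N e' (\<lambda>x. vderiv f x - poly p (complex_of_real x))"
    using Suc.IH[OF smooth_vderiv[OF Suc.prems(1)] e'(1)] by blast
  obtain q where q: "pderiv q = p" "poly q 0 = f 0" using pderiv_surj by blast
  let ?h = "\<lambda>x. f x - poly q (complex_of_real x)"
  have h: "(?h has_vector_derivative vderiv f x - poly p (complex_of_real x)) (at x)" for x
    using has_vector_derivative_diff[OF smooth_deriv[OF Suc.prems(1)] poly_has_vector_derivative[of q]] q by simp
  have "deriv_bound r (Suc N) e ?h"
    unfolding deriv_bound_def
  proof (intro allI impI)
    fix k x assume k: "k \<le> Suc N" and x: "\<bar>x\<bar> \<le> r"
    show "norm ((vderiv ^^ k) ?h x) \<le> e"
    proof (cases k)
      case 0
      have "norm (?h x - ?h 0) \<le> e' * norm (x - 0)"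
      proof (rule differentiable_bound[where S = "{-r..r}" and f = ?h
            and f' = "\<lambda>x h. h *\<^sub>R (vderiv f x - poly p (complex_of_real x))"])
        fix y assume y: "y \<in> {-r..r}"
        show "(?h has_derivative (\<lambda>h. h *\<^sub>R (vderiv f y - poly p (complex_of_real y)))) (at y within {-r..r})"
          using has_vector_derivative_at_within[OF h] by (simp add: has_vector_derivative_def)
        have "norm (vderiv f y - poly p (complex_of_real y)) \<le> e'"
          using p y unfolding deriv_bound_def by (metis abs_le_iff atLeastAtMost_iff funpow_0 le0 minus_le_iff)
        then show "onorm (\<lambda>h. h *\<^sub>R (vderiv f y - poly p (complex_of_real y))) \<le> e'"
          by (simp add: onorm_scaleR_left[OF bounded_linear_ident] onorm_id)
      qed (use x assms(3) in auto)
      also have "e' * norm (x - 0) \<le> e' * r" using x e' by (intro mult_left_mono) auto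
      finally show ?thesis using 0 q e' by (simp add: mult.commute)
    next
      case (Suc l)
      have "(vderiv ^^ k) ?h x = (vderiv ^^ l) (\<lambda>x. vderiv f x - poly p (complex_of_real x)) x"
        using vderivI[OF h] by (simp add: Suc funpow_Suc_right del: funpow.simps)
      moreover have "norm ((vderiv ^^ l) (\<lambda>x. vderiv f x - poly p (complex_of_real x)) x) \<le> e'"
        using p k x Suc by (simp add: deriv_bound_def)
      ultimately show ?thesis using e'(2) by (simp only: order_trans)
    qed
  qed
  then show ?case by blast
qed

lemma cont_functional_poly:
  assumes T: "cont_functional smooth r T"
  shows "T (\<lambda>x. poly p (complex_of_real x)) = (\<Sum>i\<le>degree p. coeff p i * T (\<lambda>x. of_real x ^ i))"
proof -
  have "T (\<lambda>x. \<Sum>i\<le>degree p. coeff p i * of_real x ^ i) = (\<Sum>i\<le>degree p. T (\<lambda>x. coeff p i * of_real x ^ i))"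
    by (intro cont_functional_sum[OF T] smooth_cmult smooth_power smooth_ident)
  also have "\<dots> = (\<Sum>i\<le>degree p. coeff p i * T (\<lambda>x. of_real x ^ i))"
    by (intro sum.cong refl cont_functional_cmult[OF T] smooth_power smooth_ident)
  finally show ?thesis by (simp add: poly_altdef)
qed

lemma conv_power:
  assumes A: "cont_functional test_fun rA A" and B: "cont_functional test_fun rB B"
  shows "conv A B (\<lambda>x. of_real x ^ l) =
    (\<Sum>i\<le>l. of_nat (l choose i) * ext_pair A (\<lambda>x. of_real x ^ i) * ext_pair B (\<lambda>x. of_real x ^ (l - i)))"
proof -
  note A' = cont_functional_ext_pair[OF A] and B' = cont_functional_ext_pair[OF B]
  let ?b = "\<lambda>i. of_nat (l choose i) * ext_pair B (\<lambda>x. of_real x ^ (l - i))"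
  have "ext_pair B (\<lambda>y2. of_real (y1 + y2) ^ l) = (\<Sum>i\<le>l. ?b i * of_real y1 ^ i)" for y1
  proof -
    have "ext_pair B (\<lambda>y2. of_real (y1 + y2) ^ l) =
        ext_pair B (\<lambda>y2. \<Sum>i\<le>l. of_nat (l choose i) * of_real y1 ^ i * of_real y2 ^ (l - i))"
      by (simp add: binomial_ring)
    also have "\<dots> = (\<Sum>i\<le>l. ext_pair B (\<lambda>y2. of_nat (l choose i) * of_real y1 ^ i * of_real y2 ^ (l - i)))"
      by (intro cont_functional_sum[OF B'] smooth_cmult smooth_power smooth_ident)
    also have "\<dots> = (\<Sum>i\<le>l. of_nat (l choose i) * of_real y1 ^ i * ext_pair B (\<lambda>y2. of_real y2 ^ (l - i)))"
      by (intro sum.cong refl cont_functional_cmult[OF B'] smooth_power smooth_ident)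
    finally show ?thesis by (simp add: mult_ac)
  qed
  then have "conv A B (\<lambda>x. of_real x ^ l) = ext_pair A (\<lambda>y1. \<Sum>i\<le>l. ?b i * of_real y1 ^ i)"
    by (simp add: conv_def)
  also have "\<dots> = (\<Sum>i\<le>l. ext_pair A (\<lambda>y1. ?b i * of_real y1 ^ i))"
    by (intro cont_functional_sum[OF A'] smooth_cmult smooth_power smooth_ident)
  also have "\<dots> = (\<Sum>i\<le>l. ?b i * ext_pair A (\<lambda>y1. of_real y1 ^ i))"
    by (intro sum.cong refl cont_functional_cmult[OF A'] smooth_power smooth_ident)
  finally show ?thesis by (simp add: mult_ac)
qed

lemma mconv_power:
  assumes A: "cont_functional test_fun rA A" and B: "cont_functional test_fun rB B"
  shows "mconv A B (\<lambda>x. of_real x ^ l) = ext_pair A (\<lambda>x. of_real x ^ l) * ext_pair B (\<lambda>x. of_real x ^ l)"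
proof -
  note A' = cont_functional_ext_pair[OF A] and B' = cont_functional_ext_pair[OF B]
  have "ext_pair B (\<lambda>y2. of_real (y1 * y2) ^ l) = ext_pair B (\<lambda>y2. of_real y2 ^ l) * of_real y1 ^ l" for y1
    using cont_functional_cmult[OF B' smooth_power[OF smooth_ident, of l], of "of_real y1 ^ l"]
    by (simp add: power_mult_distrib mult.commute)
  then show ?thesis
    unfolding mconv_def
    using cont_functional_cmult[OF A' smooth_power[OF smooth_ident, of l], of "ext_pair B (\<lambda>y2. of_real y2 ^ l)"]
    by (simp add: mult.commute)
qed

section \<open>Analytic continuation of the distributions \<open>\<phi>\<^sub>a\<^sub>b\<close>\<close>

lemma continuous_on_powr_interval:
  fixes v :: "real \<Rightarrow> real"
  assumes "continuous_on S v" "\<And>u. u \<in> S \<Longrightarrow> 0 \<le> v u" "0 < Re a"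
  shows "continuous_on S (\<lambda>u. complex_of_real (v u) powr a)"
  using assms by (intro continuous_on_powr_complex continuous_intros) auto

text \<open>Differentiating v^a in a produces ln v, singular where v = 0. Multiplied by one factor v
  it becomes continuous up to 0, with the value \<open>0 * ln 0\<close> = 0.\<close>

lemma xlnx_continuous: "continuous_on {0..} (\<lambda>x::real. x * ln x)"
  unfolding continuous_on_def
proof
  fix x :: real assume x: "x \<in> {0..}"
  show "((\<lambda>x. x * ln x) \<longlongrightarrow> x * ln x) (at x within {0..})"
  proof (cases "x = 0")
    case True
    have "((\<lambda>x::real. - (ln (inverse x) / inverse x)) \<longlongrightarrow> 0) (at_right 0)"
      using tendsto_minus[OF filterlim_compose[OF ln_x_over_x_tendsto_0 filterlim_inverse_at_top_right]]
      unfolding minus_zero .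
    then have "((\<lambda>x::real. x * ln x) \<longlongrightarrow> 0) (at_right 0)"
      by (rule Lim_transform_eventually)
        (auto simp: eventually_at_filter ln_inverse divide_inverse mult.commute)
    then show ?thesis
      using True by (simp add: at_within_Ici_at_right)
  next
    case False
    then show ?thesis using x by (intro tendsto_intros) auto
  qed
qed

text \<open>Differentiation under the integral, for v = u and v = 1 - u. The half-plane Re a > 1
  allows writing v^a ln v = (v ln v) v^(a-1) with both factors continuous on the closed
  interval.\<close>

lemma powr_integral_holomorphic:
  fixes v :: "real \<Rightarrow> real"
  assumes v: "continuous_on {0..1} v" "\<And>u. u \<in> {0..1} \<Longrightarrow> 0 \<le> v u" and g: "continuous_on {0..1} g"
  shows "(\<lambda>a. integral {0..1} (\<lambda>u. complex_of_real (v u) powr a * g u)) holomorphic_on {a. 1 < Re a}"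
proof -
  let ?U = "{a. 1 < Re a}"
  let ?d = "\<lambda>a u. of_real (v u * ln (v u)) * complex_of_real (v u) powr (a - 1) * g u"
  have "(\<lambda>a. integral (cbox 0 1) (\<lambda>u. complex_of_real (v u) powr a * g u)) holomorphic_on ?U"
  proof (rule leibniz_rule_holomorphic[where fx = ?d])
    fix a :: complex and u :: real assume a: "a \<in> ?U" and u: "u \<in> cbox 0 1"
    show "((\<lambda>a. of_real (v u) powr a * g u) has_field_derivative ?d a u) (at a within ?U)"
    proof (cases "v u = 0")
      case False
      then have pos: "v u > 0" using v(2)[of u] u by auto
      have "of_real (v u) powr a = of_real (v u) * of_real (v u) powr (a - 1)"
        using False by (simp add: powr_diff)
      then have eq: "Ln (of_real (v u)) * of_real (v u) powr a * g u = ?d a u"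
        using pos by (simp add: Ln_of_real)
      show ?thesis
        using DERIV_cmult_right[OF has_field_derivative_at_within[OF has_field_derivative_powr_right], of "of_real (v u)" "g u" a ?U] False
        unfolding eq by simp
    qed simp
  next
    fix a assume "a \<in> ?U"
    then have "continuous_on {0..1} (\<lambda>u. complex_of_real (v u) powr a * g u)"
      by (intro continuous_on_mult continuous_on_powr_interval v g) auto
    then show "(\<lambda>u. complex_of_real (v u) powr a * g u) integrable_on cbox 0 1"
      using integrable_continuous_real by fastforce
  next
    have cv: "continuous_on (?U \<times> cbox 0 1) (\<lambda>p. v (snd p))"
      by (rule continuous_on_compose2[OF v(1)]) (auto intro!: continuous_on_snd continuous_on_id)
    have cg: "continuous_on (?U \<times> cbox 0 1) (\<lambda>p. g (snd p))"
      by (rule continuous_on_compose2[OF g]) (auto intro!: continuous_on_snd continuous_on_id)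
    have cl: "continuous_on (?U \<times> cbox 0 1) (\<lambda>p. v (snd p) * ln (v (snd p)))"
      by (rule continuous_on_compose2[OF xlnx_continuous cv]) (auto intro: v(2))
    have cp: "continuous_on (?U \<times> cbox 0 1) (\<lambda>p. complex_of_real (v (snd p)) powr (fst p - 1))"
      using v(2) by (intro continuous_on_powr_complex continuous_on_of_real[OF cv] continuous_on_diff
          continuous_on_fst continuous_on_id continuous_on_const) auto
    have "continuous_on (?U \<times> cbox 0 1) (\<lambda>p. of_real (v (snd p) * ln (v (snd p))) *
        complex_of_real (v (snd p)) powr (fst p - 1) * g (snd p))"
      by (rule continuous_on_mult[OF continuous_on_mult[OF continuous_on_of_real[OF cl] cp] cg])
    then show "continuous_on (?U \<times> cbox 0 1) (\<lambda>(a, u). ?d a u)"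
      by (simp add: case_prod_unfold)
  qed (simp add: convex_halfspace_Re_gt)
  then show ?thesis by (simp add: cbox_interval)
qed

definition phi_weight :: "complex \<Rightarrow> complex \<Rightarrow> real \<Rightarrow> complex" where
  "phi_weight a b u = complex_of_real u powr a * complex_of_real (1 - u) powr b * rGamma (a + 1) * rGamma (b + 1)"

definition phi_int :: "complex \<Rightarrow> complex \<Rightarrow> distr" where
  "phi_int a b \<psi> = integral {0..1} (\<lambda>u. phi_weight a b u * \<psi> u)"

lemma phi_weight_continuous:
  "0 < Re a \<Longrightarrow> 0 < Re b \<Longrightarrow> continuous_on {0..1} (phi_weight a b)"
  unfolding phi_weight_def
  by (intro continuous_on_mult continuous_on_const continuous_on_powr_interval continuous_on_diff
      continuous_on_id) auto

lemma phi_int_integrable: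
  "0 < Re a \<Longrightarrow> 0 < Re b \<Longrightarrow> continuous_on {0..1} \<psi> \<Longrightarrow> (\<lambda>u. phi_weight a b u * \<psi> u) integrable_on {0..1}"
  by (intro integrable_continuous_real continuous_on_mult phi_weight_continuous)

lemma phi_int_holomorphic:
  assumes "continuous_on {0..1} \<psi>"
  shows "1 < Re b \<Longrightarrow> (\<lambda>a. phi_int a b \<psi>) holomorphic_on {a. 1 < Re a}"
    and "1 < Re a \<Longrightarrow> (\<lambda>b. phi_int a b \<psi>) holomorphic_on {b. 1 < Re b}"
proof -
  assume b: "1 < Re b"
  have eq: "phi_int a b \<psi> = integral {0..1} (\<lambda>u. of_real u powr a * (of_real (1 - u) powr b * \<psi> u)) *
      (rGamma (a + 1) * rGamma (b + 1))" for a
    unfolding phi_int_def phi_weight_def by (subst integral_mult_left[symmetric]) (simp add: mult_ac)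
  show "(\<lambda>a. phi_int a b \<psi>) holomorphic_on {a. 1 < Re a}"
    unfolding eq using assms b
    by (intro holomorphic_intros powr_integral_holomorphic continuous_on_mult continuous_on_powr_interval)
      (auto intro!: continuous_intros)
next
  assume a: "1 < Re a"
  have eq: "phi_int a b \<psi> = integral {0..1} (\<lambda>u. of_real (1 - u) powr b * (of_real u powr a * \<psi> u)) *
      (rGamma (a + 1) * rGamma (b + 1))" for b
    unfolding phi_int_def phi_weight_def by (subst integral_mult_left[symmetric]) (simp add: mult_ac)
  show "(\<lambda>b. phi_int a b \<psi>) holomorphic_on {b. 1 < Re b}"
    unfolding eq using assms a
    by (intro holomorphic_intros powr_integral_holomorphic continuous_on_mult continuous_on_powr_interval)
      (auto intro!: continuous_intros)
qed

text \<open>Integration by parts against the primitive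
  \<open>u\<^sup>a\<^sup>+\<^sup>1 (1 - u)\<^sup>b\<^sup>+\<^sup>1 (b + 1 - (a + b + 2) u) \<psi>(u)\<close>, chosen so that both exponents are raised at once.\<close>

lemma phi_int_step:
  assumes a: "-1 < Re a" and b: "-1 < Re b" and \<psi>: "smooth \<psi>"
  shows "phi_int a b \<psi> = (a + b + 2) * (a + b + 3) * phi_int (a + 1) (b + 1) \<psi>
    + (a + b + 2) * phi_int (a + 1) (b + 1) (\<lambda>u. of_real u * vderiv \<psi> u)
    - (b + 1) * phi_int (a + 1) (b + 1) (vderiv \<psi>)"
proof -
  define s where "s = a + b + 2"
  define W where "W u = complex_of_real u powr (a + 1) * complex_of_real (1 - u) powr (b + 1)" for u
  define w where "w u = complex_of_real u powr a * complex_of_real (1 - u) powr b" for u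
  \<comment> \<open>With s = a + b + 2 the factor b + 1 - s u is the one for which ((a+1) - s
    u)((b+1) - s u) collapses to (a+1)(b+1) - s^2 u(1-u). Differentiating therefore leaves the
    constant multiple (a+1)(b+1) of the original weight plus terms carrying u^(a+1)
    (1-u)^(b+1).\<close>
  define P where "P u = W u * (((b + 1) - s * of_real u) * \<psi> u)" for u
  define h where "h u = W u * (s * (s + 1) * \<psi> u + (s * of_real u - (b + 1)) * vderiv \<psi> u)" for u
  have cW: "continuous_on {0..1} W"
    unfolding W_def using a b
    by (intro continuous_on_mult continuous_on_powr_interval continuous_intros) auto
  note c\<psi> = smooth_continuous_on[OF \<psi>] smooth_continuous_on[OF smooth_vderiv[OF \<psi>]]
  have ch: "continuous_on {0..1} h"
    unfolding h_def by (intro continuous_intros cW c\<psi>)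
  have der: "(P has_vector_derivative (a + 1) * (b + 1) * (w u * \<psi> u) - h u) (at u)" if u: "u \<in> {0<..<1}" for u
  proof -
    have "((\<lambda>x. x powr (a + 1)) has_field_derivative (a + 1) * of_real u powr (a + 1 - 1)) (at (complex_of_real u))"
      using u by (intro has_field_derivative_powr) (auto simp: complex_nonpos_Reals_iff)
    from field_vector_diff_chain_at[OF has_vector_derivative_complex_of_real this]
    have 1: "((\<lambda>u. complex_of_real u powr (a + 1)) has_vector_derivative (a + 1) * of_real u powr a) (at u)"
      by (simp add: o_def)
    have 0: "((\<lambda>u. complex_of_real ((-1) * u + 1)) has_vector_derivative of_real (-1) * 1) (at u)"
      by (intro has_vector_derivative_affine has_vector_derivative_complex_of_real)
    have "((\<lambda>x. x powr (b + 1)) has_field_derivative (b + 1) * of_real (1 - u) powr (b + 1 - 1)) (at (complex_of_real ((-1) * u + 1)))"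
      using u has_field_derivative_powr[of "complex_of_real (1 - u)" "b + 1"] by (auto simp: complex_nonpos_Reals_iff)
    from field_vector_diff_chain_at[OF 0 this]
    have 2: "((\<lambda>u. complex_of_real (1 - u) powr (b + 1)) has_vector_derivative - ((b + 1) * of_real (1 - u) powr b)) (at u)"
      by (simp add: o_def)
    have 3: "((\<lambda>u. (b + 1) - s * of_real u) has_vector_derivative (0 - s * 1)) (at u)"
      by (intro has_vector_derivative_diff has_vector_derivative_const has_vector_derivative_mult_right
          has_vector_derivative_complex_of_real)
    note D = has_vector_derivative_mult[OF has_vector_derivative_mult[OF 1 2]
        has_vector_derivative_mult[OF 3 smooth_deriv[OF \<psi>]]]
    have pw: "complex_of_real u powr (a + 1) = of_real u * of_real u powr a"
      "complex_of_real (1 - u) powr (b + 1) = (1 - of_real u) * of_real (1 - u) powr b"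
      using u by (auto simp: powr_add mult.commute)
    have "complex_of_real u powr (a + 1) * of_real (1 - u) powr (b + 1) *
        ((b + 1 - s * of_real u) * vderiv \<psi> u + (0 - s * 1) * \<psi> u) +
        (complex_of_real u powr (a + 1) * - ((b + 1) * of_real (1 - u) powr b) +
         (a + 1) * of_real u powr a * of_real (1 - u) powr (b + 1)) * ((b + 1 - s * of_real u) * \<psi> u)
        = (a + 1) * (b + 1) * (w u * \<psi> u) - h u"
      unfolding pw w_def h_def W_def s_def by algebra
    then show ?thesis
      using D unfolding P_def W_def by simp
  qed
  have "((\<lambda>u. (a + 1) * (b + 1) * (w u * \<psi> u) - h u) has_integral (P 1 - P 0)) {0..1}"
  \<comment> \<open>At 0 and 1 the powers need not be differentiable, but \<open>P\<close> is
    continuous there and vanishes, since a + 1 and b + 1 have positive real part.\<close>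
  proof (rule fundamental_theorem_of_calculus_interior)
    show "continuous_on {0..1} P"
      unfolding P_def by (intro continuous_intros cW c\<psi>)
  qed (use der in auto)
  moreover have "P 1 = 0" "P 0 = 0" by (simp_all add: P_def W_def)
  ultimately have "((\<lambda>u. (a + 1) * (b + 1) * (w u * \<psi> u) - h u) has_integral 0) {0..1}" by simp
  from has_integral_add[OF this integrable_integral[OF integrable_continuous_real[OF ch]]]
  have I: "((\<lambda>u. (a + 1) * (b + 1) * (w u * \<psi> u)) has_integral integral {0..1} h) {0..1}" by simp
  \<comment> \<open>The normalization absorbs (a+1)(b+1), because (a+1) rGamma(a+2) = rGamma(a+1)
    and likewise for b; no division takes place.\<close>
  let ?c = "rGamma (a + 1 + 1) * rGamma (b + 1 + 1)"
  have "((\<lambda>u. ?c * ((a + 1) * (b + 1) * (w u * \<psi> u))) has_integral ?c * integral {0..1} h) {0..1}"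
    by (rule has_integral_mult_right[OF I])
  moreover have "?c * ((a + 1) * (b + 1) * (w u * \<psi> u)) = phi_weight a b u * \<psi> u" for u
    unfolding phi_weight_def w_def rGamma_plus1[of "a + 1", symmetric] rGamma_plus1[of "b + 1", symmetric]
    by (simp add: mult_ac)
  ultimately have "phi_int a b \<psi> = ?c * integral {0..1} h"
    unfolding phi_int_def by (simp only: integral_unique)
  also have "\<dots> = integral {0..1} (\<lambda>u. ?c * h u)" by simp
  also have "(\<lambda>u. ?c * h u) = (\<lambda>u. s * (s + 1) * (phi_weight (a + 1) (b + 1) u * \<psi> u)
      + s * (phi_weight (a + 1) (b + 1) u * (of_real u * vderiv \<psi> u))
      - (b + 1) * (phi_weight (a + 1) (b + 1) u * vderiv \<psi> u))"
    by (auto simp: h_def W_def phi_weight_def algebra_simps)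
  also have "integral {0..1} \<dots> = s * (s + 1) * phi_int (a + 1) (b + 1) \<psi>
      + s * phi_int (a + 1) (b + 1) (\<lambda>u. of_real u * vderiv \<psi> u)
      - (b + 1) * phi_int (a + 1) (b + 1) (vderiv \<psi>)"
  proof -
    have i: "(\<lambda>u. phi_weight (a + 1) (b + 1) u * \<psi> u) integrable_on {0..1}"
      "(\<lambda>u. phi_weight (a + 1) (b + 1) u * (of_real u * vderiv \<psi> u)) integrable_on {0..1}"
      "(\<lambda>u. phi_weight (a + 1) (b + 1) u * vderiv \<psi> u) integrable_on {0..1}"
      using a b by (auto intro!: phi_int_integrable continuous_intros c\<psi>)
    note h = i[THEN integrable_integral, THEN has_integral_mult_right]
    note int = has_integral_diff[OF has_integral_add[OF h(1) h(2)] h(3), THEN integral_unique]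
    show ?thesis unfolding phi_int_def by (rule int)
  qed
  finally show ?thesis by (simp add: s_def add_ac)
qed

lemma cont_functional_phi_int:
  assumes ab: "0 < Re a" "0 < Re b"
  shows "cont_functional smooth 1 (phi_int a b)"
  unfolding cont_functional_def
proof (intro conjI allI impI exI[of _ "0::nat"] exI[of _ "norm (rGamma (a + 1) * rGamma (b + 1))"])
  note int = phi_int_integrable[OF ab smooth_continuous_on]
  show "phi_int a b (\<lambda>x. f x + g x) = phi_int a b f + phi_int a b g" if "smooth f" "smooth g" for f g
    unfolding phi_int_def using integral_add[OF int[OF that(1)] int[OF that(2)]] by (simp add: distrib_left)
  show "phi_int a b (\<lambda>x. c * f x) = c * phi_int a b f" for c f
    unfolding phi_int_def by (subst integral_mult_right[symmetric]) (simp add: mult_ac)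
  fix f M assume f: "smooth f" "deriv_bound 1 0 M f"
  have "norm (phi_weight a b u * f u) \<le> norm (rGamma (a + 1) * rGamma (b + 1)) * M" if u: "u \<in> {0..1}" for u
  proof -
    have "norm (complex_of_real u powr a) \<le> 1" "norm (complex_of_real (1 - u) powr b) \<le> 1"
      using u ab by (auto simp: norm_powr_real_powr powr_le1)
    then have "norm (complex_of_real u powr a) * norm (complex_of_real (1 - u) powr b) \<le> 1"
      by (simp add: mult_le_one)
    moreover have "norm (f u) \<le> M" using f(2) u by (auto simp: deriv_bound_def)
    ultimately have "(norm (complex_of_real u powr a) * norm (complex_of_real (1 - u) powr b)) *
        (norm (rGamma (a + 1) * rGamma (b + 1)) * norm (f u)) \<le> 1 * (norm (rGamma (a + 1) * rGamma (b + 1)) * M)"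
      by (intro mult_mono) auto
    then show ?thesis by (simp add: phi_weight_def norm_mult mult_ac)
  qed
  then have "norm (phi_int a b f) \<le> norm (rGamma (a + 1) * rGamma (b + 1)) * M * (1 - 0)"
    unfolding phi_int_def
    by (intro integral_bound continuous_on_mult phi_weight_continuous ab smooth_continuous_on f) auto
  then show "norm (phi_int a b f) \<le> norm (rGamma (a + 1) * rGamma (b + 1)) * M" by simp
qed auto

section \<open>Operations on functionals: combinations, differentiation, multiplication by u\<close>

lemma cont_functional_comb:
  assumes S: "cont_functional smooth r S" and T: "cont_functional smooth r T"
  shows "cont_functional smooth r (\<lambda>f. c * S f + d * T f)"
proof -
  obtain C N where CN: "0 \<le> C" "\<forall>f M. smooth f \<longrightarrow> deriv_bound r N M f \<longrightarrow> norm (S f) \<le> C * M"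
    using cont_functional_bound[OF S] by blast
  obtain C' N' where CN': "0 \<le> C'" "\<forall>f M. smooth f \<longrightarrow> deriv_bound r N' M f \<longrightarrow> norm (T f) \<le> C' * M"
    using cont_functional_bound[OF T] by blast
  show ?thesis
    unfolding cont_functional_def
  proof (intro conjI allI impI exI[of _ "max N N'"] exI[of _ "norm c * C + norm d * C'"])
    fix f M assume f: "smooth f" "deriv_bound r (max N N') M f"
    have "norm (S f) \<le> C * M" "norm (T f) \<le> C' * M"
      using CN(2) CN'(2) f(1) deriv_bound_mono[OF f(2) order_refl _ order_refl] by simp_all
    then have "norm c * norm (S f) + norm d * norm (T f) \<le> norm c * (C * M) + norm d * (C' * M)"
      by (intro add_mono mult_left_mono) auto
    then show "norm (c * S f + d * T f) \<le> (norm c * C + norm d * C') * M"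
      using norm_triangle_ineq[of "c * S f" "d * T f"] by (simp add: norm_mult algebra_simps)
  next
    fix f g assume "smooth f" "smooth g"
    then show "c * S (\<lambda>x. f x + g x) + d * T (\<lambda>x. f x + g x) = c * S f + d * T f + (c * S g + d * T g)"
      using cont_functional_add[OF S] cont_functional_add[OF T] by (simp add: algebra_simps)
  next
    fix e f assume "smooth f"
    then show "c * S (\<lambda>x. e * f x) + d * T (\<lambda>x. e * f x) = e * (c * S f + d * T f)"
      using cont_functional_cmult[OF S] cont_functional_cmult[OF T] by (simp add: algebra_simps)
  qed (use CN CN' in auto)
qed

lemma smooth_ident_mult: "smooth f \<Longrightarrow> smooth (\<lambda>u. of_real u * f u)"
  by (intro smooth_mult smooth_ident)

lemma vderiv_add: "smooth f \<Longrightarrow> smooth g \<Longrightarrow> vderiv (\<lambda>x. f x + g x) = (\<lambda>x. vderiv f x + vderiv g x)"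
  using vderiv_funpow_add[of f g 1] by simp

lemma vderiv_cmult: "smooth f \<Longrightarrow> vderiv (\<lambda>x. c * f x) = (\<lambda>x. c * vderiv f x)"
  using vderiv_funpow_cmult[of f 1 c] by simp

lemma deriv_bound_vderiv: "deriv_bound r (Suc N) M f \<Longrightarrow> deriv_bound r N M (vderiv f)"
  unfolding deriv_bound_def
proof (intro allI impI)
  fix k x assume *: "\<forall>k\<le>Suc N. \<forall>x. \<bar>x\<bar> \<le> r \<longrightarrow> norm ((vderiv ^^ k) f x) \<le> M" "k \<le> N" "\<bar>x\<bar> \<le> r"
  have "norm ((vderiv ^^ Suc k) f x) \<le> M"
    using *(1)[rule_format, of "Suc k" x] *(2,3) by simp
  then show "norm ((vderiv ^^ k) (vderiv f) x) \<le> M" by (simp add: funpow_swap1)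
qed

lemma cont_functional_vderiv:
  assumes T: "cont_functional smooth r T"
  shows "cont_functional smooth r (\<lambda>f. T (vderiv f))"
proof -
  obtain C N where CN: "0 \<le> C" "\<forall>f M. smooth f \<longrightarrow> deriv_bound r N M f \<longrightarrow> norm (T f) \<le> C * M"
    using cont_functional_bound[OF T] by blast
  show ?thesis
    unfolding cont_functional_def
  proof (intro conjI allI impI exI[of _ "Suc N"] exI[of _ C] CN(1))
    show "T (vderiv (\<lambda>x. f x + g x)) = T (vderiv f) + T (vderiv g)" if "smooth f" "smooth g" for f g
      unfolding vderiv_add[OF that] by (intro cont_functional_add[OF T] smooth_vderiv that)
    show "T (vderiv (\<lambda>x. c * f x)) = c * T (vderiv f)" if "smooth f" for c f
      unfolding vderiv_cmult[OF that] by (intro cont_functional_cmult[OF T] smooth_vderiv that)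
    show "norm (T (vderiv f)) \<le> C * M" if "smooth f" "deriv_bound r (Suc N) M f" for f M
      using CN(2) smooth_vderiv[OF that(1)] deriv_bound_vderiv[OF that(2)] by blast
  qed
qed

lemma cont_functional_ident_mult:
  assumes T: "cont_functional smooth r T" and r: "0 \<le> r"
  shows "cont_functional smooth r (\<lambda>f. T (\<lambda>u. of_real u * f u))"
proof -
  obtain C N where CN: "0 \<le> C" "\<forall>f M. smooth f \<longrightarrow> deriv_bound r N M f \<longrightarrow> norm (T f) \<le> C * M"
    using cont_functional_bound[OF T] by blast
  \<comment> \<open>Multiplication by u is \<open>scaled 1 f 1\<close>, so the dilation estimate
    replaces a Leibniz formula.\<close>
  obtain D where D: "\<And>k. D k \<ge> 0"
    "\<And>k f M y u. smooth f \<Longrightarrow> deriv_bound (1 * r) k M f \<Longrightarrow> \<bar>y\<bar> \<le> 1 \<Longrightarrow> \<bar>u\<bar> \<le> r \<Longrightarrow>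
      norm ((vderiv ^^ k) (scaled 1 f y) u) \<le> D k * M"
    using scaled_bound[OF zero_le_one r, of _ 1] by metis
  define E where "E = (\<Sum>k\<le>N. D k)"
  have E: "D k \<le> E" if "k \<le> N" for k
    unfolding E_def by (rule member_le_sum) (use that D in auto)
  have E0: "0 \<le> E" unfolding E_def by (intro sum_nonneg D)
  show ?thesis
    unfolding cont_functional_def
  proof (intro conjI allI impI exI[of _ N] exI[of _ "C * E"])
    show "T (\<lambda>u. of_real u * (f u + g u)) = T (\<lambda>u. of_real u * f u) + T (\<lambda>u. of_real u * g u)"
      if "smooth f" "smooth g" for f g
      using cont_functional_add[OF T smooth_ident_mult[OF that(1)] smooth_ident_mult[OF that(2)]]
      by (simp add: distrib_left)
    show "T (\<lambda>u. of_real u * (c * f u)) = c * T (\<lambda>u. of_real u * f u)" if "smooth f" for c f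
      using cont_functional_cmult[OF T smooth_ident_mult[OF that], of c] by (simp add: mult_ac)
    fix f M assume f: "smooth f" "deriv_bound r N M f"
    have M: "0 \<le> M" using deriv_bound_nonneg[OF f(2) r] .
    have "deriv_bound r N (E * M) (\<lambda>u. of_real u * f u)"
      unfolding deriv_bound_def
    proof (intro allI impI)
      fix k u assume k: "k \<le> N" and u: "\<bar>u\<bar> \<le> r"
      have "deriv_bound (1 * r) k M f" using deriv_bound_mono[OF f(2) _ k order_refl] by simp
      from D(2)[OF f(1) this _ u, of 1]
      have "norm ((vderiv ^^ k) (\<lambda>u. of_real u * f u) u) \<le> D k * M" by (simp add: scaled_def)
      also have "\<dots> \<le> E * M" using E[OF k] M by (rule mult_right_mono)
      finally show "norm ((vderiv ^^ k) (\<lambda>u. of_real u * f u) u) \<le> E * M" .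
    qed
    then show "norm (T (\<lambda>u. of_real u * f u)) \<le> C * E * M"
      using CN(2) smooth_ident_mult[OF f(1)] by (simp add: mult.assoc)
  qed (use CN E0 in simp)
qed

section \<open>Continuation by iterated integration by parts\<close>

text \<open>\<open>phi_int_step\<close> read as a definition: n steps reach the integral with
  exponents a + n and b + n, which converges for Re a, Re b > -1 - n.\<close>

fun phi_ext :: "nat \<Rightarrow> complex \<Rightarrow> complex \<Rightarrow> distr" where
  "phi_ext 0 a b \<psi> = phi_int a b \<psi>"
| "phi_ext (Suc n) a b \<psi> = (a + b + 2) * (a + b + 3) * phi_ext n (a + 1) (b + 1) \<psi>
    + (a + b + 2) * phi_ext n (a + 1) (b + 1) (\<lambda>u. of_real u * vderiv \<psi> u)
    - (b + 1) * phi_ext n (a + 1) (b + 1) (vderiv \<psi>)"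

text \<open>Consistency of successive continuations: \<open>phi_int_step\<close> is the case n = 0,
  and each later step applies the claim to the three functions in the recursion.\<close>

lemma phi_ext_Suc:
  "smooth \<psi> \<Longrightarrow> -1 - real n < Re a \<Longrightarrow> -1 - real n < Re b \<Longrightarrow> phi_ext (Suc n) a b \<psi> = phi_ext n a b \<psi>"
proof (induction n arbitrary: a b \<psi>)
  case 0
  then have "-1 < Re a" "-1 < Re b" by simp_all
  then show ?case
    unfolding phi_ext.simps using phi_int_step[of a b \<psi>] 0(1) by (simp only:)
next
  case (Suc n)
  have "phi_ext (Suc n) (a + 1) (b + 1) f = phi_ext n (a + 1) (b + 1) f" if "smooth f" for f
    using that Suc.prems by (intro Suc.IH) auto
  note eq = this[OF Suc.prems(1)] this[OF smooth_vderiv[OF Suc.prems(1)]]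
    this[OF smooth_ident_mult[OF smooth_vderiv[OF Suc.prems(1)]]]
  show ?case
    unfolding phi_ext.simps(2)[of "Suc n" a b] eq phi_ext.simps(2)[of n a b] ..
qed

lemma phi_ext_le:
  assumes "smooth \<psi>" "-1 - real n < Re a" "-1 - real n < Re b" "n \<le> m"
  shows "phi_ext m a b \<psi> = phi_ext n a b \<psi>"
  using assms(4)
proof (induction m rule: dec_induct)
  case (step k)
  have "phi_ext (Suc k) a b \<psi> = phi_ext k a b \<psi>"
    using assms step by (intro phi_ext_Suc) auto
  then show ?case using step by simp
qed simp

lemma phi_ext_eq:
  assumes "smooth \<psi>" "-1 - real n < Re a" "-1 - real n < Re b" "-1 - real m < Re a" "-1 - real m < Re b"
  shows "phi_ext m a b \<psi> = phi_ext n a b \<psi>"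
  using phi_ext_le[of \<psi> n a b m] phi_ext_le[of \<psi> m a b n] assms by (cases "n \<le> m") auto

lemma holomorphic_shift:
  assumes "f holomorphic_on {a. c < Re a}"
  shows "(\<lambda>a. f (a + 1)) holomorphic_on {a. c - 1 < Re a}"
  by (rule holomorphic_on_compose_gen[OF _ assms, of "\<lambda>a. a + 1", unfolded o_def])
    (auto intro!: holomorphic_intros)

text \<open>The half-plane starts at Re > 1, where \<open>phi_int\<close> was shown holomorphic, and
  every recursion step moves it left by one.\<close>

lemma phi_ext_holomorphic1:
  "smooth \<psi> \<Longrightarrow> 1 - real n < Re b \<Longrightarrow> (\<lambda>a. phi_ext n a b \<psi>) holomorphic_on {a. 1 - real n < Re a}"
proof (induction n arbitrary: b \<psi>)
  case 0
  then show ?case using phi_int_holomorphic(1)[OF smooth_continuous_on] by simp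
next
  case (Suc n)
  have "(\<lambda>a. phi_ext n (a + 1) (b + 1) f) holomorphic_on {a. 1 - real (Suc n) < Re a}" if "smooth f" for f
    using holomorphic_shift[OF Suc.IH[OF that, of "b + 1"]] Suc.prems(2) by (simp add: diff_diff_add add.commute)
  note eq = this[OF Suc.prems(1)] this[OF smooth_vderiv[OF Suc.prems(1)]]
    this[OF smooth_ident_mult[OF smooth_vderiv[OF Suc.prems(1)]]]
  show ?case
    unfolding phi_ext.simps by (intro holomorphic_intros eq)
qed

lemma phi_ext_holomorphic2:
  "smooth \<psi> \<Longrightarrow> 1 - real n < Re a \<Longrightarrow> (\<lambda>b. phi_ext n a b \<psi>) holomorphic_on {b. 1 - real n < Re b}"
proof (induction n arbitrary: a \<psi>)
  case 0
  then show ?case using phi_int_holomorphic(2)[OF smooth_continuous_on] by simp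
next
  case (Suc n)
  have "(\<lambda>b. phi_ext n (a + 1) (b + 1) f) holomorphic_on {a. 1 - real (Suc n) < Re a}" if "smooth f" for f
    using holomorphic_shift[OF Suc.IH[OF that, of "a + 1"]] Suc.prems(2) by (simp add: diff_diff_add add.commute)
  note eq = this[OF Suc.prems(1)] this[OF smooth_vderiv[OF Suc.prems(1)]]
    this[OF smooth_ident_mult[OF smooth_vderiv[OF Suc.prems(1)]]]
  show ?case
    unfolding phi_ext.simps by (intro holomorphic_intros eq)
qed

lemma cont_functional_phi_ext:
  "- real n < Re a \<Longrightarrow> - real n < Re b \<Longrightarrow> cont_functional smooth 1 (phi_ext n a b)"
proof (induction n arbitrary: a b)
  case 0
  have "phi_ext 0 a b = phi_int a b" by (auto simp: fun_eq_iff)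
  then show ?case using 0 cont_functional_phi_int by simp
next
  case (Suc n)
  have IH: "cont_functional smooth 1 (phi_ext n (a + 1) (b + 1))"
    using Suc.prems by (intro Suc.IH) auto
  note c = cont_functional_comb[OF cont_functional_comb[OF IH
      cont_functional_vderiv[OF cont_functional_ident_mult[OF IH zero_le_one]],
      of "(a + b + 2) * (a + b + 3)" "a + b + 2"] cont_functional_vderiv[OF IH], of 1 "- (b + 1)"]
  have "phi_ext (Suc n) a b = (\<lambda>f. 1 * ((a + b + 2) * (a + b + 3) * phi_ext n (a + 1) (b + 1) f +
      (a + b + 2) * phi_ext n (a + 1) (b + 1) (\<lambda>u. of_real u * vderiv f u))
      + - (b + 1) * phi_ext n (a + 1) (b + 1) (vderiv f))"
    by (auto simp: fun_eq_iff algebra_simps)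
  with c show ?case by (simp only:)
qed

text \<open>The identity theorem used twice in one variable: for fixed positive b it extends the
  equality to all a, then for each a to all b. The positive reals accumulate at 1.\<close>

lemma entire2_eqI:
  fixes f g :: "complex \<Rightarrow> complex \<Rightarrow> complex"
  assumes f: "\<And>b. (\<lambda>a. f a b) holomorphic_on UNIV" "\<And>a. f a holomorphic_on UNIV"
    and g: "\<And>b. (\<lambda>a. g a b) holomorphic_on UNIV" "\<And>a. g a holomorphic_on UNIV"
    and eq: "\<And>a b. 0 < a \<Longrightarrow> 0 < b \<Longrightarrow> f (of_real a) (of_real b) = g (of_real a) (of_real b)"
  shows "f a b = g a b"
proof -
  let ?U = "complex_of_real ` {0<..}"
  have lim: "1 islimpt ?U"
  proof -
    have "1 islimpt {0<..<2::real}" by (intro open_imp_islimpt) auto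
    then have "(1::real) islimpt {0<..}" by (rule islimpt_subset) auto
    then have "of_real 1 islimpt ?U"
      by (rule islimpt_isCont_image) (auto simp: eventually_at_filter)
    then show ?thesis by simp
  qed
  have *: "h w = 0" if "h holomorphic_on UNIV" "\<And>x. 0 < x \<Longrightarrow> h (of_real x) = 0" for h w
    by (rule analytic_continuation[OF that(1) open_UNIV connected_UNIV subset_UNIV UNIV_I lim _ UNIV_I])
      (use that(2) in auto)
  have 1: "f a (of_real b) - g a (of_real b) = 0" if "0 < b" for a b
    by (rule *[OF holomorphic_on_diff[OF f(1) g(1)]]) (simp add: eq that)
  have "f a b - g a b = 0"
    by (rule *[OF holomorphic_on_diff[OF f(2) g(2)]]) (simp add: 1)
  then show ?thesis by simp
qed

text \<open>For a fixed value c of the other parameter's real part, the half-planes on which some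
  \<open>phi_ext n\<close> is holomorphic exhaust the plane.\<close>

lemma halfspace_UNIV: "(\<Union>n\<in>{n. 1 - real n < c}. {a. 1 - real n < Re a}) = UNIV"
proof -
  have "a \<in> (\<Union>n\<in>{n. 1 - real n < c}. {a. 1 - real n < Re a})" for a
  proof -
    obtain n where "max (1 - c) (1 - Re a) < real n" using reals_Archimedean2 by blast
    then show ?thesis by (intro UN_I[of n]) auto
  qed
  then show ?thesis by blast
qed

text \<open>Resolves the \<open>THE\<close>: patching the \<open>phi_ext n\<close> gives a solution
  \<open>F\<close>, and \<open>entire2_eqI\<close> shows it is the only one. The value 0 off the
  test functions, prescribed in the definition, fixes the rest.\<close>

lemma phi_ab_family_props:
  shows "test_fun \<psi> \<Longrightarrow> (\<lambda>a. phi_ab a b \<psi>) holomorphic_on UNIV"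
    and "test_fun \<psi> \<Longrightarrow> (\<lambda>b. phi_ab a b \<psi>) holomorphic_on UNIV"
    and "test_fun \<psi> \<Longrightarrow> 1 - real n < Re a \<Longrightarrow> 1 - real n < Re b \<Longrightarrow> phi_ab a b \<psi> = phi_ext n a b \<psi>"
    and "test_fun \<psi> \<Longrightarrow> -1 < Re a \<Longrightarrow> -1 < Re b \<Longrightarrow> phi_ab a b \<psi> = phi_int a b \<psi>"
proof -
  define N where "N a b = (SOME n. 1 - real n < Re a \<and> 1 - real n < Re b)" for a b
  define F where "F a b \<psi> = (if test_fun \<psi> then phi_ext (N a b) a b \<psi> else 0)" for a b \<psi>
  have N: "1 - real (N a b) < Re a \<and> 1 - real (N a b) < Re b" for a b
  proof -
    obtain n where "max (1 - Re b) (1 - Re a) < real n" using reals_Archimedean2 by blast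
    then have "1 - real n < Re a \<and> 1 - real n < Re b" by auto
    then show ?thesis unfolding N_def by (rule someI)
  qed
  \<comment> \<open>Any admissible n computes \<open>F\<close>, not only the chosen
    \<open>N a b\<close>; so near a given parameter n can be held constant, which gives
    holomorphy.\<close>
  have F_ext: "F a b \<psi> = phi_ext n a b \<psi>"
    if "test_fun \<psi>" "-1 - real n < Re a" "-1 - real n < Re b" for n a b \<psi>
    using that N[of a b] by (auto simp: F_def intro!: phi_ext_eq test_fun_smooth)
  have F_int: "F a b \<psi> = phi_int a b \<psi>" if "test_fun \<psi>" "-1 < Re a" "-1 < Re b" for a b \<psi>
    using F_ext[of \<psi> 0 a b] that by simp
  have F_hol1: "(\<lambda>a. F a b \<psi>) holomorphic_on UNIV" if \<psi>: "test_fun \<psi>" for b \<psi>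
    unfolding halfspace_UNIV[of "Re b", symmetric]
  proof (rule holomorphic_on_UN_open)
    fix n assume "n \<in> {n. 1 - real n < Re b}"
    then show "(\<lambda>a. F a b \<psi>) holomorphic_on {a. 1 - real n < Re a}"
      using phi_ext_holomorphic1[OF test_fun_smooth[OF \<psi>], of n b]
      by (subst holomorphic_cong[OF refl F_ext[OF \<psi>, of n]]) auto
  qed (simp add: open_halfspace_Re_gt)
  have F_hol2: "(\<lambda>b. F a b \<psi>) holomorphic_on UNIV" if \<psi>: "test_fun \<psi>" for a \<psi>
    unfolding halfspace_UNIV[of "Re a", symmetric]
  proof (rule holomorphic_on_UN_open)
    fix n assume "n \<in> {n. 1 - real n < Re a}"
    then show "(\<lambda>b. F a b \<psi>) holomorphic_on {a. 1 - real n < Re a}"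
      using phi_ext_holomorphic2[OF test_fun_smooth[OF \<psi>], of n a]
      by (subst holomorphic_cong[OF refl F_ext[OF \<psi>, of n]]) auto
  qed (simp add: open_halfspace_Re_gt)
  let ?P = "\<lambda>F. (\<forall>\<psi>. test_fun \<psi> \<longrightarrow>
        (\<forall>b. (\<lambda>a. F a b \<psi>) holomorphic_on UNIV) \<and> (\<forall>a. (\<lambda>b. F a b \<psi>) holomorphic_on UNIV)) \<and>
     (\<forall>\<psi> a b. test_fun \<psi> \<longrightarrow> Re a > -1 \<longrightarrow> Re b > -1 \<longrightarrow>
        F a b \<psi> = integral {0..1} (\<lambda>u. (complex_of_real u powr a) * (complex_of_real (1 - u) powr b)
                      * rGamma (a + 1) * rGamma (b + 1) * \<psi> u)) \<and>
     (\<forall>\<psi> a b. \<not> test_fun \<psi> \<longrightarrow> F a b \<psi> = 0)"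
  have "phi_ab_family = F"
    unfolding phi_ab_family_def
  proof (rule the_equality)
    show "?P F"
      using F_hol1 F_hol2 F_int by (auto simp: F_def phi_int_def phi_weight_def)
    fix G assume G: "?P G"
    have "G a b \<psi> = F a b \<psi>" for a b \<psi>
    proof (cases "test_fun \<psi>")
      case True
      show ?thesis
      proof (rule entire2_eqI[where f = "\<lambda>a b. G a b \<psi>" and g = "\<lambda>a b. F a b \<psi>"])
        fix a b :: real assume ab: "0 < a" "0 < b"
        have "G (of_real a) (of_real b) \<psi> = phi_int (of_real a) (of_real b) \<psi>"
          using G True ab unfolding phi_int_def phi_weight_def by force
        then show "G (of_real a) (of_real b) \<psi> = F (of_real a) (of_real b) \<psi>"
          using F_int[OF True] ab by simp
      qed (use G True F_hol1 F_hol2 in auto)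
    qed (use G in \<open>simp add: F_def\<close>)
    then show "G = F" by (simp add: fun_eq_iff)
  qed
  then have eq: "phi_ab a b = F a b" for a b by (simp add: phi_ab_def)
  show "test_fun \<psi> \<Longrightarrow> (\<lambda>a. phi_ab a b \<psi>) holomorphic_on UNIV"
    "test_fun \<psi> \<Longrightarrow> (\<lambda>b. phi_ab a b \<psi>) holomorphic_on UNIV"
    "test_fun \<psi> \<Longrightarrow> 1 - real n < Re a \<Longrightarrow> 1 - real n < Re b \<Longrightarrow> phi_ab a b \<psi> = phi_ext n a b \<psi>"
    "test_fun \<psi> \<Longrightarrow> -1 < Re a \<Longrightarrow> -1 < Re b \<Longrightarrow> phi_ab a b \<psi> = phi_int a b \<psi>"
    unfolding eq by (simp_all add: F_hol1 F_hol2 F_int F_ext)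
qed

lemma cont_functional_phi_ab: "cont_functional test_fun 1 (phi_ab a b)"
proof -
  obtain n where n: "max (1 - Re b) (1 - Re a) < real n" using reals_Archimedean2 by blast
  have "cont_functional test_fun 1 (phi_ext n a b)"
    by (intro cont_functional_smooth_imp_test cont_functional_phi_ext) (use n in auto)
  moreover have "phi_ab a b \<psi> = phi_ext n a b \<psi>" if "test_fun \<psi>" for \<psi>
    using n that by (intro phi_ab_family_props(3)) auto
  ultimately show ?thesis
    unfolding cont_functional_def by (simp add: test_fun_add test_fun_cmult)
qed

text \<open>Both sides are entire in a and in b, so positive real parameters suffice. There the
  pairing is a beta integral, B(a+p+1, b+1) / (Gamma(a+1) Gamma(b+1)).\<close>

lemma phi_ab_moment:
  "ext_pair (phi_ab a b) (\<lambda>x. of_real x ^ p) = pochhammer (a + 1) p * rGamma (a + b + of_nat p + 2)"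
proof -
  \<comment> \<open>The bump is 1 on [0,1], so it drops out of the integral; the form
    \<open>1 + 1\<close> matches r + 1 for the radius r = 1 of \<open>phi_ab\<close>.\<close>
  obtain c where c: "test_fun c" "\<forall>x. \<bar>x\<bar> < 1 + 1 \<longrightarrow> c x = 1"
    using bump_exists[of "1 + 1"] by blast
  define \<psi> where "\<psi> x = c x * of_real x ^ p" for x
  have \<psi>: "test_fun \<psi>"
    unfolding \<psi>_def by (intro test_fun_mult c smooth_power smooth_ident)
  have "phi_ab a b \<psi> = pochhammer (a + 1) p * rGamma (a + b + of_nat p + 2)"
  proof (rule entire2_eqI[where f = "\<lambda>a b. phi_ab a b \<psi>" and
        g = "\<lambda>a b. pochhammer (a + 1) p * rGamma (a + b + of_nat p + 2)"])
    fix a b :: real assume ab: "0 < a" "0 < b"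
    let ?a = "complex_of_real a" and ?b = "complex_of_real b"
    let ?c = "rGamma (?a + 1) * rGamma (?b + 1)"
    have "((\<lambda>t. t powr (a + p + 1 - 1) * (1 - t) powr (b + 1 - 1)) has_integral Beta (a + p + 1) (b + 1)) {0..1}"
      using ab by (intro has_integral_Beta_real) auto
    then have "((\<lambda>t. ?c * complex_of_real (t powr (a + p) * (1 - t) powr b)) has_integral
        ?c * complex_of_real (Beta (a + p + 1) (b + 1))) {0..1}"
      by (intro has_integral_mult_right has_integral_of_real) simp
    moreover have "?c * complex_of_real (t powr (a + p) * (1 - t) powr b) = phi_weight ?a ?b t * \<psi> t"
      if "t \<in> {0..1}" for t
    proof -
      have "t powr (a + p) = t powr a * t ^ p"
        using that ab by (cases "t = 0") (auto simp: powr_add powr_realpow)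
      then show ?thesis
        using that c(2) ab by (simp add: phi_weight_def \<psi>_def powr_of_real[symmetric])
    qed
    ultimately have "((\<lambda>t. phi_weight ?a ?b t * \<psi> t) has_integral ?c * complex_of_real (Beta (a + p + 1) (b + 1))) {0..1}"
      by (rule has_integral_eq[rotated])
    then have "phi_ab ?a ?b \<psi> = ?c * complex_of_real (Beta (a + p + 1) (b + 1))"
      using phi_ab_family_props(4)[OF \<psi>, of ?a ?b] ab by (simp add: phi_int_def integral_unique)
    also have "\<dots> = complex_of_real (rGamma (a + 1) * rGamma (b + 1) * (Gamma (a + p + 1) * Gamma (b + 1) / Gamma (a + p + 1 + (b + 1))))"
      by (simp add: Beta_def rGamma_complex_of_real[symmetric])
    also have "rGamma (a + 1) * rGamma (b + 1) * (Gamma (a + p + 1) * Gamma (b + 1) / Gamma (a + p + 1 + (b + 1)))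
        = pochhammer (a + 1) p * rGamma (a + b + p + 2)"
    proof -
      have "Gamma (a + 1) > 0" "Gamma (b + 1) > 0" using ab by (auto intro!: Gamma_real_pos)
      moreover have "pochhammer (a + 1) p = Gamma (a + 1 + p) / Gamma (a + 1)"
        using ab by (intro pochhammer_Gamma) (auto elim!: nonpos_Ints_cases)
      moreover have "a + p + 1 + (b + 1) = a + b + p + 2" "a + p + 1 = a + 1 + p" by simp_all
      ultimately show ?thesis
        by (simp only: rGamma_inverse_Gamma) (simp add: divide_inverse)
    qed
    finally show "phi_ab ?a ?b \<psi> = pochhammer (?a + 1) p * rGamma (?a + ?b + of_nat p + 2)"
      by (simp add: rGamma_complex_of_real[symmetric] pochhammer_of_real[symmetric])
  qed (auto intro!: phi_ab_family_props \<psi> holomorphic_intros)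
  then show ?thesis
    using ext_pair_eq_bump[OF cont_functional_phi_ab smooth_power[OF smooth_ident] c, of a b p]
    by (simp add: \<psi>_def[abs_def])
qed

section \<open>The moment identity\<close>

text \<open>Chu-Vandermonde for a difference. The reflection (-x)_q = (-1)^q (x-q+1)_q turns (c-w)_q
  into (-1)^q times the rising factorial of the sum w + (1-c-q); expanding and reflecting the second
  factor back leaves the sign (-1)^i.\<close>

lemma pochhammer_Vandermonde_minus:
  fixes c w :: "'a::comm_ring_1"
  shows "pochhammer (c - w) q =
    (\<Sum>i\<le>q. (-1) ^ i * of_nat (q choose i) * pochhammer w i * pochhammer (c + of_nat i) (q - i))"
proof -
  have A: "pochhammer (1 - c - of_nat q) (q - i) = (-1) ^ (q - i) * pochhammer (c + of_nat i) (q - i)"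
    if "i \<le> q" for i
  proof -
    have "pochhammer (- (c + of_nat q - 1)) (q - i) =
        (-1) ^ (q - i) * pochhammer (c + of_nat q - 1 - of_nat (q - i) + 1) (q - i)"
      by (rule pochhammer_minus)
    moreover have "- (c + of_nat q - 1) = 1 - c - of_nat q" by simp
    moreover have "c + of_nat q - 1 - of_nat (q - i) + 1 = c + of_nat i"
      using that by (simp add: of_nat_diff)
    ultimately show ?thesis by (simp only:)
  qed
  have "pochhammer (- (c - w + of_nat q - 1)) q = (-1) ^ q * pochhammer (c - w + of_nat q - 1 - of_nat q + 1) q"
    by (rule pochhammer_minus)
  moreover have "- (c - w + of_nat q - 1) = w + (1 - c - of_nat q)" by simp
  moreover have "c - w + of_nat q - 1 - of_nat q + 1 = c - w" by simp
  ultimately have "(-1) ^ q * pochhammer (c - w) q = pochhammer (w + (1 - c - of_nat q)) q" by (simp only:)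
  also have "\<dots> = (\<Sum>i\<le>q. of_nat (q choose i) * pochhammer w i * pochhammer (1 - c - of_nat q) (q - i))"
    by (rule pochhammer_binomial_sum)
  also have "\<dots> = (\<Sum>i\<le>q. of_nat (q choose i) * pochhammer w i * ((-1) ^ (q - i) * pochhammer (c + of_nat i) (q - i)))"
    by (intro sum.cong refl) (simp add: A)
  finally have "(-1) ^ q * ((-1) ^ q * pochhammer (c - w) q) = (-1) ^ q *
      (\<Sum>i\<le>q. of_nat (q choose i) * pochhammer w i * ((-1) ^ (q - i) * pochhammer (c + of_nat i) (q - i)))"
    by (rule arg_cong)
  also have "\<dots> = (\<Sum>i\<le>q. ((-1) ^ q * (-1) ^ (q - i)) * of_nat (q choose i) * pochhammer w i * pochhammer (c + of_nat i) (q - i))"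
    by (simp add: sum_distrib_left mult_ac)
  also have "\<dots> = (\<Sum>i\<le>q. (-1) ^ i * of_nat (q choose i) * pochhammer w i * pochhammer (c + of_nat i) (q - i))"
  proof (intro sum.cong refl)
    fix i assume "i \<in> {..q}"
    then have "q + (q - i) = i + 2 * (q - i)" by simp
    then have "(-1::'a) ^ q * (-1) ^ (q - i) = (-1) ^ i"
      by (metis power_add power_minus1_even mult.right_neutral)
    then show "(-1) ^ q * (-1) ^ (q - i) * of_nat (q choose i) * pochhammer w i * pochhammer (c + of_nat i) (q - i) =
        (-1) ^ i * of_nat (q choose i) * pochhammer w i * pochhammer (c + of_nat i) (q - i)" by simp
  qed
  finally show ?thesis by (simp flip: mult.assoc power_mult_distrib)
qed

lemma pochhammer_of_nat_Suc:
  "fact n * pochhammer (of_nat n + 1) k = (fact (n + k) :: 'a::{semiring_char_0,comm_semiring_1})"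
  using pochhammer_product'[of "1::'a" n k] by (simp add: pochhammer_fact add.commute)

text \<open>The left side is the sum in \<open>sigma1_moment\<close>; the right side splits into
  factors in x alone and y alone, as the moments of a convolution do. Each of the two Vandermonde
  summations contributes one factor (l+1)!.\<close>

lemma double_pochhammer_sum:
  fixes x y :: complex
  shows "(\<Sum>p\<le>l. (-1) ^ (l - p) * pochhammer (x + 1) p * pochhammer (1 - x) (l - p)
        * pochhammer (y + 1) p * pochhammer (1 - y) (l - p) / (fact p * fact (l - p)))
    = fact (l + 1) * fact (l + 1) * (\<Sum>j\<le>l. (-1) ^ (l - j) * pochhammer (x + 1) j * pochhammer (1 - y) (l - j)
        / (fact j * fact (l - j) * fact (j + 1) * fact (l - j + 1)))"
proof -
  define t where "t p i = (-1) ^ (l - p) * (-1) ^ i * pochhammer (x + 1) (p + i) * (fact (l + 1) / fact (p + i + 1))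
      * of_nat ((l - p) choose i) * pochhammer (y + 1) p * pochhammer (1 - y) (l - p) / (fact p * fact (l - p))" for p i
  have inner: "(-1) ^ (l - p) * pochhammer (x + 1) p * pochhammer (1 - x) (l - p)
        * pochhammer (y + 1) p * pochhammer (1 - y) (l - p) / (fact p * fact (l - p)) = (\<Sum>i\<le>l - p. t p i)"
    if p: "p \<le> l" for p
  proof -
    have "pochhammer (x + 1) p * pochhammer (1 - x) (l - p) =
        (\<Sum>i\<le>l - p. pochhammer (x + 1) p * ((-1) ^ i * of_nat ((l - p) choose i) * pochhammer (x + 1 + of_nat p) i
          * pochhammer (of_nat (p + 2) + of_nat i) (l - p - i)))"
      \<comment> \<open>The choice c = p + 2, w = x + 1 + p gives c - w = 1 - x, while (x+1)_p
        (x+1+p)_i merges into (x+1)_(p+i) and (p+2+i)_(l-p-i) becomes (l+1)!/(p+i+1)!.\<close>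
      using pochhammer_Vandermonde_minus[of "of_nat (p + 2)" "x + 1 + of_nat p" "l - p"]
      by (simp add: sum_distrib_left algebra_simps)
    also have "\<dots> = (\<Sum>i\<le>l - p. (-1) ^ i * of_nat ((l - p) choose i) * pochhammer (x + 1) (p + i) * (fact (l + 1) / fact (p + i + 1)))"
    proof (intro sum.cong refl)
      fix i assume i: "i \<in> {..l - p}"
      have "fact (p + i + 1) * pochhammer (of_nat (p + i + 1) + 1) (l - p - i) = (fact (p + i + 1 + (l - p - i)) :: complex)"
        by (rule pochhammer_of_nat_Suc)
      also have "p + i + 1 + (l - p - i) = l + 1" using i p by simp
      finally have "pochhammer (of_nat (p + 2) + of_nat i) (l - p - i) = (fact (l + 1) / fact (p + i + 1) :: complex)"
        by (simp add: eq_divide_eq add_ac mult.commute del: fact_Suc)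
      then show "pochhammer (x + 1) p * ((-1) ^ i * of_nat ((l - p) choose i) * pochhammer (x + 1 + of_nat p) i
          * pochhammer (of_nat (p + 2) + of_nat i) (l - p - i)) =
          (-1) ^ i * of_nat ((l - p) choose i) * pochhammer (x + 1) (p + i) * (fact (l + 1) / fact (p + i + 1))"
        unfolding pochhammer_product'[of "x + 1" p i] by (simp only: mult_ac)
    qed
    finally have e: "pochhammer (x + 1) p * pochhammer (1 - x) (l - p) = \<dots>" .
    have "(-1) ^ (l - p) * pochhammer (x + 1) p * pochhammer (1 - x) (l - p)
        * pochhammer (y + 1) p * pochhammer (1 - y) (l - p) / (fact p * fact (l - p)) =
        (pochhammer (x + 1) p * pochhammer (1 - x) (l - p)) *
        ((-1) ^ (l - p) * pochhammer (y + 1) p * pochhammer (1 - y) (l - p) / (fact p * fact (l - p)))"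
      by simp
    also have "\<dots> = (\<Sum>i\<le>l - p. t p i)"
      unfolding e sum_distrib_right t_def by (intro sum.cong refl) simp
    finally show ?thesis .
  qed
  have "(\<Sum>p\<le>l. (-1) ^ (l - p) * pochhammer (x + 1) p * pochhammer (1 - x) (l - p)
        * pochhammer (y + 1) p * pochhammer (1 - y) (l - p) / (fact p * fact (l - p))) = (\<Sum>p\<le>l. \<Sum>i\<le>l - p. t p i)"
    by (intro sum.cong refl inner) simp
  also have "\<dots> = (\<Sum>(p, i)\<in>{(p, i). p + i \<le> l}. t p i)"
    by (subst sum.Sigma) (auto intro!: sum.cong)
  also have "\<dots> = (\<Sum>j\<le>l. \<Sum>p\<le>j. t p (j - p))"
    by (rule sum.triangle_reindex_eq)
  also have "\<dots> = (\<Sum>j\<le>l. fact (l + 1) * fact (l + 1) * ((-1) ^ (l - j) * pochhammer (x + 1) j * pochhammer (1 - y) (l - j)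
        / (fact j * fact (l - j) * fact (j + 1) * fact (l - j + 1))))"
  proof (intro sum.cong refl)
    fix j assume j: "j \<in> {..l}"
    \<comment> \<open>The part independent of p once j = p + i is fixed; what remains is a
      Vandermonde sum over p.\<close>
    define K where "K = (-1) ^ (l - j) * pochhammer (x + 1) j * (fact (l + 1) / fact (j + 1))
        * pochhammer (1 - y) (l - j) / (fact j * fact (l - j))"
    have "(\<Sum>p\<le>j. t p (j - p)) = (\<Sum>p\<le>j. K * (of_nat (j choose p) * pochhammer (y + 1) p * pochhammer (1 - y + of_nat (l - j)) (j - p)))"
    proof (intro sum.cong refl)
      fix p assume p: "p \<in> {..j}"
      have "l - p + (j - p) = (l - j) + 2 * (j - p)" using p j by simp
      then have s: "(-1::complex) ^ (l - p) * (-1) ^ (j - p) = (-1) ^ (l - j)"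
        by (metis power_add power_minus1_even mult.right_neutral)
      have lp: "l - p = (l - j) + (j - p)" using p j by simp
      have po: "pochhammer (1 - y) (l - p) = pochhammer (1 - y) (l - j) * pochhammer (1 - y + of_nat (l - j)) (j - p)"
        unfolding lp by (rule pochhammer_product')
      have b1: "of_nat ((l - p) choose (j - p)) = (fact (l - p) / (fact (j - p) * fact (l - j)) :: complex)"
        using binomial_fact[of "j - p" "l - p"] lp by simp
      have b2: "of_nat (j choose p) = (fact j / (fact p * fact (j - p)) :: complex)"
        using p by (simp add: binomial_fact)
      have "t p (j - p) = ((-1) ^ (l - p) * (-1) ^ (j - p)) * pochhammer (x + 1) j * (fact (l + 1) / fact (j + 1))
          * of_nat ((l - p) choose (j - p)) * pochhammer (y + 1) p * pochhammer (1 - y) (l - p) / (fact p * fact (l - p))"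
        using p by (simp add: t_def)
      also have "\<dots> = K * (of_nat (j choose p) * pochhammer (y + 1) p * pochhammer (1 - y + of_nat (l - j)) (j - p))"
        unfolding s po b1 b2 K_def by (simp add: field_simps del: fact_Suc)
      finally show "t p (j - p) = K * (of_nat (j choose p) * pochhammer (y + 1) p * pochhammer (1 - y + of_nat (l - j)) (j - p))" .
    qed
    also have "\<dots> = K * pochhammer (y + 1 + (1 - y + of_nat (l - j))) j"
      by (simp only: sum_distrib_left[symmetric] pochhammer_binomial_sum)
    \<comment> \<open>Here y cancels: the base is l - j + 2, so the symbol is a quotient of
      factorials.\<close>
    also have "pochhammer (y + 1 + (1 - y + of_nat (l - j))) j = fact (l + 1) / fact (l - j + 1)"
    proof -
      have "fact (l - j + 1) * pochhammer (of_nat (l - j + 1) + 1) j = (fact (l - j + 1 + j) :: complex)"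
        by (rule pochhammer_of_nat_Suc)
      moreover have "l - j + 1 + j = l + 1" using j by simp
      moreover have "of_nat (l - j + 1) + 1 = y + 1 + (1 - y + of_nat (l - j))" by simp
      ultimately show ?thesis by (simp only:) (simp add: field_simps del: fact_Suc)
    qed
    finally show "(\<Sum>p\<le>j. t p (j - p)) = fact (l + 1) * fact (l + 1) * ((-1) ^ (l - j) * pochhammer (x + 1) j * pochhammer (1 - y) (l - j)
        / (fact j * fact (l - j) * fact (j + 1) * fact (l - j + 1)))"
      by (simp add: K_def mult_ac del: fact_Suc)
  qed
  finally show ?thesis by (simp only: sum_distrib_left)
qed

section \<open>Comparison of moments\<close>

lemma ext_pair_reflect:
  assumes B: "cont_functional test_fun r B" and f: "smooth f"
  shows "ext_pair (reflect B) f = ext_pair B (\<lambda>u. f (- u))"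
proof -
  obtain c where c: "test_fun c" "\<forall>x. \<bar>x\<bar> < r + 1 \<longrightarrow> c x = 1"
    using bump_exists[of "r + 1"] by blast
  have "ext_pair (reflect B) f = B (\<lambda>u. c (- u) * f (- u))"
    using ext_pair_eq_bump[OF cont_functional_reflect[OF B] f c] by (simp add: reflect_def)
  moreover have "smooth (\<lambda>u. f (- u))" using smooth_affine[OF f, of "-1" 0] by simp
  then have "ext_pair B (\<lambda>u. f (- u)) = B (\<lambda>u. c (- u) * f (- u))"
    by (rule ext_pair_eq_bump[OF B _ test_fun_uminus[OF c(1)]]) (use c(2) in simp)
  ultimately show ?thesis by simp
qed

text \<open>Opposite exponents make the Gamma factor independent of a, namely Gamma(p+2) =
  (p+1)!.\<close>

lemma phi_ab_opposite_moment:
  "ext_pair (phi_ab a (- a)) (\<lambda>x. of_real x ^ p) = pochhammer (a + 1) p / fact (p + 1)"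
proof -
  have "rGamma (a + - a + of_nat p + 2) = inverse (fact (p + 1) :: complex)"
    using Gamma_fact[of "p + 1", where 'a=complex] by (simp add: rGamma_inverse_Gamma add_ac)
  then show ?thesis unfolding phi_ab_moment by (simp add: divide_inverse)
qed

lemma reflect_phi_ab_moment:
  "ext_pair (reflect (phi_ab (- a) a)) (\<lambda>x. of_real x ^ q) = (-1) ^ q * pochhammer (1 - a) q / fact (q + 1)"
proof -
  have "ext_pair (reflect (phi_ab (- a) a)) (\<lambda>x. of_real x ^ q) =
      ext_pair (phi_ab (- a) a) (\<lambda>x. (-1) ^ q * of_real x ^ q)"
    using ext_pair_reflect[OF cont_functional_phi_ab smooth_power[OF smooth_ident]]
    by (simp flip: power_mult_distrib)
  also have "\<dots> = (-1) ^ q * ext_pair (phi_ab (- a) a) (\<lambda>x. of_real x ^ q)"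
    by (intro cont_functional_cmult[OF cont_functional_ext_pair[OF cont_functional_phi_ab]] smooth_power smooth_ident)
  also have "ext_pair (phi_ab (- a) a) (\<lambda>x. of_real x ^ q) = pochhammer (1 - a) q / fact (q + 1)"
    using phi_ab_opposite_moment[of "- a" q] by simp
  finally show ?thesis by simp
qed

lemma sigma1_moment_eq:
  "sigma1_moment z z' l = z * z' / (pochhammer (z * z') (l + 1) * of_nat (l + 1)) *
    (\<Sum>p\<le>l. (-1) ^ (l - p) * pochhammer (z + 1) p * pochhammer (1 - z) (l - p)
        * pochhammer (z' + 1) p * pochhammer (1 - z') (l - p) / (fact p * fact (l - p)))"
  unfolding sigma1_moment_def Let_def sum_distrib_left atMost_atLeast0
  by (intro sum.cong refl) (simp add: add.commute mult_ac)

abbreviation (input) sigma1_distr :: "complex \<Rightarrow> complex \<Rightarrow> distr" where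
  "sigma1_distr z z' \<equiv>
     mconv (conv (phi_ab z (- z)) (reflect (phi_ab (- z') z'))) (phi_ab 1 (z * z' - 2))"

lemma cont_functional_conv_phi: "cont_functional smooth 2 (conv (phi_ab z (- z)) (reflect (phi_ab (- z') z')))"
  using cont_functional_conv[OF cont_functional_phi_ab cont_functional_reflect[OF cont_functional_phi_ab]] by simp

text \<open>The radius is 2 = (1 + 1) * 1, the a priori bound from the factors; that the result is
  carried by [-1,1] comes out of the comparison with the measure.\<close>

lemma cont_functional_sigma1_distr: "cont_functional smooth 2 (sigma1_distr z z')"
  using cont_functional_mconv[OF cont_functional_smooth_imp_test[OF cont_functional_conv_phi] cont_functional_phi_ab]
  by simp

lemma sigma1_distr_moment:
  assumes t: "z * z' \<notin> \<int>\<^sub>\<le>\<^sub>0"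
  shows "Gamma (z * z' + 1) * sigma1_distr z z' (\<lambda>x. of_real x ^ l) = sigma1_moment z z' l"
proof -
  define t where "t = z * z'"
  define S where "S = (\<Sum>j\<le>l. (-1) ^ (l - j) * pochhammer (z + 1) j * pochhammer (1 - z') (l - j)
        / (fact j * fact (l - j) * fact (j + 1) * fact (l - j + 1)))"
  let ?C = "conv (phi_ab z (- z)) (reflect (phi_ab (- z') z'))"
  have C: "ext_pair ?C (\<lambda>x. of_real x ^ l) = fact l * S"
  proof -
    have "ext_pair ?C (\<lambda>x. of_real x ^ l) = ?C (\<lambda>x. of_real x ^ l)"
      by (intro ext_pair_smooth[OF cont_functional_conv_phi] smooth_power smooth_ident)
    also have "\<dots> = (\<Sum>i\<le>l. of_nat (l choose i) * (pochhammer (z + 1) i / fact (i + 1)) *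
        ((-1) ^ (l - i) * pochhammer (1 - z') (l - i) / fact (l - i + 1)))"
      unfolding conv_power[OF cont_functional_phi_ab cont_functional_reflect[OF cont_functional_phi_ab]]
        phi_ab_opposite_moment reflect_phi_ab_moment ..
    also have "\<dots> = fact l * S"
      unfolding S_def sum_distrib_left
      by (intro sum.cong refl) (simp add: binomial_fact mult_ac del: fact_Suc)
    finally show ?thesis .
  qed
  have K: "ext_pair (phi_ab 1 (t - 2)) (\<lambda>x. of_real x ^ l) = fact (l + 1) * rGamma (t + of_nat (l + 1))"
  proof -
    have "pochhammer (1 + 1) l = (fact (l + 1) :: complex)"
      using pochhammer_of_nat_Suc[of 1 l, where 'a=complex] by simp
    moreover have "1 + (t - 2) + of_nat l + 2 = t + of_nat (l + 1)" by simp
    ultimately show ?thesis unfolding phi_ab_moment by (simp only:)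
  qed
  \<comment> \<open>This is where t avoids the nonpositive integers: Gamma(t+1) / Gamma(t+l+1) = t /
    (t)_(l+1).\<close>
  have G: "Gamma (t + 1) * rGamma (t + of_nat (l + 1)) = t / pochhammer t (l + 1)"
  proof -
    have "Gamma (t + 1) = t * Gamma t"
      using t by (intro Gamma_plus1) (auto simp: t_def)
    moreover have "pochhammer t (l + 1) = Gamma (t + of_nat (l + 1)) / Gamma t"
      using t unfolding t_def by (rule pochhammer_Gamma)
    ultimately show ?thesis by (simp only: rGamma_inverse_Gamma) (simp add: divide_inverse)
  qed
  have "Gamma (t + 1) * sigma1_distr z z' (\<lambda>x. of_real x ^ l) =
      (Gamma (t + 1) * rGamma (t + of_nat (l + 1))) * (fact l * fact (l + 1) * S)"
    unfolding mconv_power[OF cont_functional_smooth_imp_test[OF cont_functional_conv_phi] cont_functional_phi_ab]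
      C K[unfolded t_def] t_def by (simp only: mult_ac)
  \<comment> \<open>Uses l! (l+1)! = (l+1)!^2 / (l+1); the factor 1/(l+1) is the one in
    \<open>sigma1_moment\<close>, and (l+1)!^2 is what \<open>double_pochhammer_sum\<close>
    needs.\<close>
  also have "\<dots> = t / (pochhammer t (l + 1) * of_nat (l + 1)) * (fact (l + 1) * fact (l + 1) * S)"
    unfolding G by (simp add: fact_Suc divide_simps del: of_nat_Suc)
  also have "\<dots> = sigma1_moment z z' l"
    unfolding sigma1_moment_eq double_pochhammer_sum S_def t_def ..
  finally show ?thesis by (simp add: t_def)
qed

section \<open>Admissible parameters and division by |x|\<close>

text \<open>In the conjugate case the product is |z|^2 with z nonzero, 0 being an integer. In the
  real case the common interval (m, m+1) lies on one side of 0, so both factors have the same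
  sign.\<close>

lemma admissible_mult_pos:
  assumes "admissible z z'"
  obtains r where "0 < r" "z * z' = complex_of_real r"
proof -
  from assms consider "z' = cnj z" "z \<notin> \<int>"
    | m :: int where "Im z = 0" "Im z' = 0" "of_int m < Re z" "Re z < of_int m + 1"
      "of_int m < Re z'" "Re z' < of_int m + 1"
    unfolding admissible_def by blast
  then show ?thesis
  proof cases
    case 1
    then have "z \<noteq> 0" by auto
    then show ?thesis
      using that[of "(norm z)\<^sup>2"] 1 by (simp add: complex_norm_square[symmetric])
  next
    case 2
    have "0 < Re z * Re z'"
    proof (cases "0 \<le> m")
      case True
      then have "(0::real) \<le> of_int m" by simp
      then show ?thesis using 2 by (intro mult_pos_pos) linarith+
    next
      case False
      then have "m + 1 \<le> 0" by simp
      then have "real_of_int m + 1 \<le> 0" by (metis of_int_1 of_int_add of_int_le_0_iff)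
      then show ?thesis using 2 by (intro mult_neg_neg) linarith+
    qed
    moreover have "z * z' = complex_of_real (Re z * Re z')"
      using 2 by (simp add: complex_eq_iff)
    ultimately show ?thesis using that by blast
  qed
qed

text \<open>1/|x| is sgn(x)/x, and the function vanishes near 0, so
  \<open>smooth_divide_ident\<close> and \<open>smooth_sgn\<close> apply in turn.\<close>

lemma test_fun_divide_abs:
  assumes \<psi>: "test_fun \<psi>" and 0: "0 \<notin> closure {x. \<psi> x \<noteq> 0}"
  shows "test_fun (\<lambda>x. \<psi> x / complex_of_real \<bar>x\<bar>)"
proof -
  have "\<forall>\<^sub>F x in nhds 0. x \<in> - closure {x. \<psi> x \<noteq> 0}"
    using 0 by (intro eventually_nhds_in_open) auto
  then have z: "\<forall>\<^sub>F x in nhds 0. \<psi> x = 0"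
    by eventually_elim (use closure_subset[of "{x. \<psi> x \<noteq> 0}"] in auto)
  then have "\<forall>\<^sub>F x in nhds 0. \<psi> x / of_real x = 0"
    by eventually_elim auto
  with z have "smooth (\<lambda>x. of_real (sgn x) * (\<psi> x / of_real x))"
    by (intro smooth_sgn smooth_divide_ident test_fun_smooth \<psi>)
  moreover have "of_real (sgn x) * (\<psi> x / of_real x) = \<psi> x / complex_of_real \<bar>x\<bar>" for x
    by (cases "x > 0"; cases "x < 0") auto
  moreover have "bounded {x. \<psi> x / complex_of_real \<bar>x\<bar> \<noteq> 0}"
    by (rule bounded_subset[of "{x. \<psi> x \<noteq> 0}"]) (use \<psi> in \<open>auto simp: test_fun_iff\<close>)
  ultimately show ?thesis unfolding test_fun_iff by simp
qed

section \<open>Finite measures on [-1,1] and their comparison with a functional\<close>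

context
  fixes \<sigma> :: "real measure"
  assumes sets: "sets \<sigma> = sets borel"
    and fin: "finite_measure \<sigma>"
    and supp: "emeasure \<sigma> (- {-1..1}) = 0"
begin

lemma AE_support: "AE x in \<sigma>. \<bar>x\<bar> \<le> 1"
proof (rule AE_I[OF _ supp])
  have "space \<sigma> = UNIV" using sets_eq_imp_space_eq[OF sets] by simp
  then show "{x \<in> space \<sigma>. \<not> \<bar>x\<bar> \<le> 1} \<subseteq> - {-1..1}" by auto
  show "- {-1..1} \<in> sets \<sigma>" unfolding sets by simp
qed

lemma measurable_continuous:
  fixes f :: "real \<Rightarrow> complex"
  shows "continuous_on UNIV f \<Longrightarrow> f \<in> borel_measurable \<sigma>"
  using borel_measurable_continuous_onI[of f] measurable_cong_sets[OF sets refl] by blast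

lemma integrable_continuous:
  fixes f :: "real \<Rightarrow> complex"
  assumes "continuous_on UNIV f"
  shows "integrable \<sigma> f"
proof -
  have "compact (f ` {-1..1})"
    using assms by (intro compact_continuous_image) (auto intro: continuous_on_subset)
  then obtain B where B: "\<forall>x\<in>{-1..1}. norm (f x) \<le> B"
    using compact_imp_bounded bounded_iff by (metis imageI)
  show ?thesis
  proof (rule finite_measure.integrable_const_bound[OF fin _ measurable_continuous[OF assms]])
    show "AE x in \<sigma>. norm (f x) \<le> B"
      using AE_support by eventually_elim (use B in \<open>auto simp: abs_le_iff\<close>)
  qed
qed

text \<open>Equal moments give equality on polynomials. A polynomial e-close to
  \<open>\<psi>\<close> in C^N on [-r,r], which contains [-1,1] because r >= 1, changes either side
  by at most a fixed multiple of e.\<close>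

lemma integral_eq_cont_functional:
  assumes T: "cont_functional smooth r T" and r: "1 \<le> r"
    and mom: "\<And>l. complex_of_real (\<integral>x. x ^ l \<partial>\<sigma>) = c * T (\<lambda>x. of_real x ^ l)"
    and \<psi>: "smooth \<psi>"
  shows "(\<integral>x. \<psi> x \<partial>\<sigma>) = c * T \<psi>"
proof -
  obtain C N where CN: "0 \<le> C" "\<forall>f M. smooth f \<longrightarrow> deriv_bound r N M f \<longrightarrow> norm (T f) \<le> C * M"
    using cont_functional_bound[OF T] by blast
  define D where "D = norm ((\<integral>x. \<psi> x \<partial>\<sigma>) - c * T \<psi>)"
  define K where "K = measure \<sigma> (space \<sigma>) + norm c * C"
  have K0: "0 \<le> K" unfolding K_def using CN(1) by simp
  have D_le: "D \<le> e * K" if e: "0 < e" for e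
  proof -
    obtain p where p: "deriv_bound r N e (\<lambda>x. \<psi> x - poly p (complex_of_real x))"
      using smooth_poly_approx[OF \<psi> e, of r N] r by auto
    let ?p = "\<lambda>x. poly p (complex_of_real x)"
    have int: "integrable \<sigma> \<psi>" "integrable \<sigma> ?p"
      by (intro integrable_continuous smooth_continuous_on \<psi> smooth_poly)+
    have "(\<integral>x. ?p x \<partial>\<sigma>) = (\<integral>x. (\<Sum>i\<le>degree p. coeff p i * of_real x ^ i) \<partial>\<sigma>)"
      by (simp add: poly_altdef)
    also have "\<dots> = (\<Sum>i\<le>degree p. (\<integral>x. coeff p i * of_real x ^ i \<partial>\<sigma>))"
      by (intro Bochner_Integration.integral_sum integrable_continuous continuous_intros)
    also have "\<dots> = (\<Sum>i\<le>degree p. coeff p i * (c * T (\<lambda>x. of_real x ^ i)))"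
    proof (intro sum.cong refl)
      fix i
      have "(\<integral>x. complex_of_real x ^ i \<partial>\<sigma>) = complex_of_real (\<integral>x. x ^ i \<partial>\<sigma>)"
        by (simp flip: integral_complex_of_real)
      then show "(\<integral>x. coeff p i * of_real x ^ i \<partial>\<sigma>) = coeff p i * (c * T (\<lambda>x. of_real x ^ i))"
        using mom[of i] by simp
    qed
    also have "\<dots> = c * T ?p"
      unfolding cont_functional_poly[OF T] sum_distrib_left by (simp add: mult_ac)
    finally have P: "(\<integral>x. ?p x \<partial>\<sigma>) = c * T ?p" .
    have "norm (T (\<lambda>x. \<psi> x - ?p x)) \<le> C * e"
      using CN(2) p smooth_diff[OF \<psi> smooth_poly] by blast
    then have "norm (T \<psi> - T ?p) \<le> C * e"
      using cont_functional_diff[OF T \<psi> smooth_poly smooth_cmult[OF smooth_poly], of p] by simp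
    then have 1: "norm (c * T \<psi> - c * T ?p) \<le> norm c * (C * e)"
      unfolding right_diff_distrib[symmetric] norm_mult by (intro mult_left_mono) auto
    have "norm (\<integral>x. \<psi> x - ?p x \<partial>\<sigma>) \<le> (\<integral>x. norm (\<psi> x - ?p x) \<partial>\<sigma>)"
      by (rule integral_norm_bound)
    also have "\<dots> \<le> (\<integral>x. e \<partial>\<sigma>)"
    proof (rule integral_mono_AE)
      show "AE x in \<sigma>. norm (\<psi> x - ?p x) \<le> e"
        using AE_support
      proof eventually_elim
        case (elim x)
        then show ?case using p[unfolded deriv_bound_def, rule_format, of 0 x] r by simp
      qed
    qed (use int fin in \<open>auto intro: finite_measure.integrable_const\<close>)
    also have "\<dots> = e * measure \<sigma> (space \<sigma>)" by simp
    finally have 2: "norm ((\<integral>x. \<psi> x \<partial>\<sigma>) - c * T ?p) \<le> e * measure \<sigma> (space \<sigma>)"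
      using int P by simp
    have "D \<le> norm ((\<integral>x. \<psi> x \<partial>\<sigma>) - c * T ?p) + norm (c * T \<psi> - c * T ?p)"
      unfolding D_def by (metis norm_triangle_ineq4 diff_diff_eq2 diff_add_cancel)
    then show ?thesis using 1 2 by (simp add: K_def algebra_simps)
  qed
  have "D = 0"
  proof (rule ccontr)
    assume "D \<noteq> 0"
    then have "D > 0" by (simp add: D_def)
    \<comment> \<open>The choice e = D / (K + 1) makes the bound strictly smaller than D.\<close>
    then have "D \<le> D / (K + 1) * K" using K0 by (intro D_le) simp
    then show False using \<open>D > 0\<close> K0 by (simp add: field_simps)
  qed
  then show ?thesis by (simp add: D_def)
qed

text \<open>The two integrands agree on all of [-1,1]: at x = 0 the left one vanishes by the
  indicator and the right one because division by 0 gives 0. The complement of [-1,1] is a null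
  set.\<close>

lemma integral_rho1:
  assumes "test_fun \<psi>"
  shows "(\<integral>x. \<psi> x \<partial>(rho1 \<sigma>)) = (\<integral>x. \<psi> x / complex_of_real \<bar>x\<bar> \<partial>\<sigma>)"
proof -
  let ?g = "\<lambda>x::real. indicator ({-1..1} - {0}) x / \<bar>x\<bar> :: real"
  have m: "\<psi> \<in> borel_measurable \<sigma>"
    by (intro measurable_continuous smooth_continuous_on test_fun_smooth assms)
  have "?g \<in> borel_measurable borel" by measurable
  then have g: "?g \<in> borel_measurable \<sigma>"
    using measurable_cong_sets[OF sets refl] by blast
  have "(\<integral>x. \<psi> x \<partial>(rho1 \<sigma>)) = (\<integral>x. ?g x *\<^sub>R \<psi> x \<partial>\<sigma>)"
    unfolding rho1_def by (rule integral_density[OF m g]) auto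
  also have "\<dots> = (\<integral>x. \<psi> x / complex_of_real \<bar>x\<bar> \<partial>\<sigma>)"
  proof (rule integral_cong_AE)
    show "(\<lambda>x. ?g x *\<^sub>R \<psi> x) \<in> borel_measurable \<sigma>" using m g by measurable
    have "(\<lambda>x. complex_of_real \<bar>x\<bar>) \<in> borel_measurable \<sigma>"
      by (intro measurable_continuous continuous_intros)
    then show "(\<lambda>x. \<psi> x / complex_of_real \<bar>x\<bar>) \<in> borel_measurable \<sigma>" using m by measurable
    show "AE x in \<sigma>. ?g x *\<^sub>R \<psi> x = \<psi> x / complex_of_real \<bar>x\<bar>"
      using AE_support
      by eventually_elim (auto simp: indicator_def scaleR_conv_of_real divide_inverse mult.commute)
  qed
  finally show ?thesis .
qed

end

theorem theorem5p8:
  fixes z z' :: complex and \<sigma> :: "real measure"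
  assumes adm: "admissible z z'"
    and sets: "sets \<sigma> = sets borel"
    and fin: "finite_measure \<sigma>"
    and supp: "emeasure \<sigma> (- {-1..1}) = 0"
    and mom: "\<forall>l. complex_of_real (\<integral>x. x ^ l \<partial>\<sigma>) = sigma1_moment z z' l"
  shows "(\<forall>\<psi>. test_fun \<psi> \<longrightarrow>
            (\<integral>x. \<psi> x \<partial>\<sigma>) =
              Gamma (z * z' + 1) *
              mconv (conv (phi_ab z (- z)) (reflect (phi_ab (- z') z'))) (phi_ab 1 (z * z' - 2)) \<psi>)
       \<and> (\<forall>\<psi>. test_fun \<psi> \<longrightarrow> 0 \<notin> closure {x. \<psi> x \<noteq> 0} \<longrightarrow>
            (\<integral>x. \<psi> x \<partial>(rho1 \<sigma>)) =
              Gamma (z * z' + 1) *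
              mconv (conv (phi_ab z (- z)) (reflect (phi_ab (- z') z'))) (phi_ab 1 (z * z' - 2))
                (\<lambda>x. \<psi> x / complex_of_real \<bar>x\<bar>))"
proof -
  obtain r where r: "0 < r" "z * z' = complex_of_real r"
    using admissible_mult_pos[OF adm] by blast
  have "z * z' \<notin> \<int>\<^sub>\<le>\<^sub>0"
    using r by (auto elim!: nonpos_Ints_cases simp: complex_eq_iff)
  note moments = sigma1_distr_moment[OF this]
  have main: "(\<integral>x. \<psi> x \<partial>\<sigma>) = Gamma (z * z' + 1) * sigma1_distr z z' \<psi>" if "test_fun \<psi>" for \<psi>
    by (rule integral_eq_cont_functional[OF sets fin supp cont_functional_sigma1_distr])
      (use mom moments that in \<open>simp_all add: test_fun_smooth\<close>)
  \<comment> \<open>The second claim is \<open>main\<close> applied to \<open>\<psi>\<close> divided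
    by |x|, a test function because the support of \<open>\<psi>\<close> avoids 0.\<close>
  then show ?thesis
    using integral_rho1[OF sets fin supp] test_fun_divide_abs by simp
qed

end
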